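(* Let $\mathfrak g$ be of type $A_n$ and let $v=v(c_1,\dots,c_n)$ where $c_1,\dots,c_n\in\{\pm1\}$; identify $v$ with $v\otimes1\in V$. 1) Let $n=2m-1$. (i) $v$ is a singular vector if and only if $c_{2j-1}=1$ for $j=1,2,\dots,m-1$. In this case the weight of $v$ is determined by $c_{2m-1}$: for any choice of $c_2,c_4,\dots,c_{2m-2}\in\{\pm1\}$, $v(1,c_2,1,c_4,\dots,1,c_{2m-2},1)$ has weight $\widetilde\Lambda_m$ and $v(1,c_2,1,c_4,\dots,1,c_{2m-2},-1)$ has weight $\widetilde\Lambda_{m-1}$. (ii) Given a singular vector $v_0=v(1,c_2,1,c_4,\dots,1,c_{2m-2},c_{2m-1})$, the $\mathbf C$-linear span of all elements $v(b_1,c_2,b_3,c_4,\dots,b_{2m-3},c_{2m-2},b_{2m-1})$ satisfying (a) $b_j\in\{\pm1\}$ for all $j$, (b) $\prod_{1\le j\le2m-1,\ j\ \mathrm{odd}}b_j=c_{2m-1}$, tensored with $\mathbf C[x^{(j)}_r;1\le j\le2m-1,\ r\in\mathbf N_{\rm odd}]$, is the irreducible $A^{(2)}_{2m-1}$-module with highest weight vector $v_0$. 2) Let $n=2m$. (i) $v$ is a singular vector if and only if $c_{2j-1}=1$ for $j=1,2,\dots,m$. In this case the weight of $v(1,c_2,1,c_4,\dots,1,c_{2m-2},1,c_{2m})$ is $\widetilde\Lambda_m$ for any choice of $c_2,c_4,\dots,c_{2m}\in\{\pm1\}$. (ii) Given a singular vector $v_0=v(1,c_2,1,c_4,\dots,1,c_{2m-2},1,c_{2m})$,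 the $\mathbf C$-linear span of all elements $v(b_1,c_2,b_3,c_4,\dots,b_{2m-3},c_{2m-2},b_{2m-1},c_{2m})$, where $b_j\in\{\pm1\}$ for all $j$, tensored with $\mathbf C[x^{(j)}_r;1\le j\le2m,\ r\in\mathbf N_{\rm odd}]$, is the irreducible $A^{(2)}_{2m}$-module with highest weight vector $v_0$.
   Context: $m\ge2$. $\mathbf N_{\rm odd}$: positive odd integers; $\mathbf Z_{\rm odd}$: odd integers; $i=\sqrt{-1}$. **Lie algebra.** $\mathfrak g$ is the complex simple Lie algebra of type $A_n$ with Cartan subalgebra $\mathfrak h$, roots $\Delta$, root lattice $Q$, invariant form normalized by $(\alpha|\alpha)=2$ ($\alpha\in\Delta$); $\mathfrak h\cong\mathfrak h^*$ via the form, $H_\alpha\leftrightarrow\alpha$. Simple roots $\alpha_1,\dots,\alpha_n$ form the chain $\alpha_1-\alpha_2-\cdots-\alpha_n$. $\nu:Q\times Q\to\{\pm1\}$ is the bimultiplicative function with $\nu(\alpha_j,\alpha_k)=-1$ if $j=k$, or if $|j-k|=1$ and $j$ is even; $\nu(\alpha_j,\alpha_k)=1$ otherwise. Root vectors $X_\alpha$ satisfy $[X_\alpha,X_\beta]=\nu(\alpha,\beta)X_{\alpha+\beta}$ if $\alpha+\beta\in\Delta$, $[X_\alpha,X_{-\alpha}]=-H_\alpha$. $\sigma$ is the automorphism with $\sigma|_{\mathfrak h}=-1$, $\sigma(X_\alpha)=X_{-\alpha}$; $\mathfrak g_{\bar0},\mathfrak g_{\bar1}$ are its $\pm1$ eigenspaces.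 $\widehat{\mathfrak g}(\sigma)=\big(\bigoplus_{j\in\mathbf Z}\mathfrak g_{\bar j\bmod2}\otimes t^j\big)\oplus\mathbf CK\oplus\mathbf Cd$ with $[X\otimes t^j,Y\otimes t^k]=[X,Y]\otimes t^{j+k}+\frac j2(X|Y)\delta_{j+k,0}K$, $[d,X\otimes t^j]=jX\otimes t^j$, $K$ central. It is the affine algebra of type $A^{(2)}_n$. **Representation.** $\mathbf C\{Q/2Q\}$ is the commutative group algebra of $Q/2Q$ (basis $e^\gamma$, $e^\alpha e^\beta=e^{\alpha+\beta}$), $V=\mathbf C\{Q/2Q\}\otimes\mathbf C[x^{(j)}_r;1\le j\le n,r\in\mathbf N_{\rm odd}]$. With an orthonormal basis $S_1,\dots,S_n$ of $\mathfrak h$, $\widehat{\mathfrak g}(\sigma)$ acts on $V$ by (coefficientwise in $z$) $$\sum_{j\in\mathbf Z}(X_\alpha+(-1)^jX_{-\alpha})\otimes t^j\,z^{-j}\mapsto\Gamma_\alpha(z),\quad \sum_{j\in\mathbf Z_{\rm odd}}H\otimes t^j\,z^{-j-1}\mapsto\tfrac1{\sqrt2}\sum_{j}(H|S_j)a^{(j)}(z),$$ $K\mapsto1$, $d\mapsto-\sum_{j,r}r\,x^{(j)}_r\partial/\partial x^{(j)}_r$, where $a^{(j)}(z)=\sum_{r\in\mathbf N_{\rm odd}}\big(z^{-r-1}\partial/\partial x^{(j)}_r+r\,x^{(j)}_rz^{r-1}\big)$ and, with $\lambda_j=\sqrt2(\alpha|S_j)$, $$\Gamma_\alpha(z)(e^\gamma\otimes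 f)=\tfrac12\nu(\alpha,\gamma)e^{\alpha+\gamma}\otimes\exp\Big(\sum_{j,\,r\in\mathbf N_{\rm odd}}\lambda_jx^{(j)}_rz^r\Big)\exp\Big(-\sum_{j,\,r\in\mathbf N_{\rm odd}}\lambda_j\frac{z^{-r}}r\frac\partial{\partial x^{(j)}_r}\Big)f.$$ Set $v(c_1,\dots,c_n)=\prod_{j=1}^n(1+ic_je^{\alpha_j})\in\mathbf C\{Q/2Q\}$. **Generators.** $Y_\alpha=X_\alpha+X_{-\alpha}\in\mathfrak g_{\bar0}=\mathfrak g_{\bar0}\otimes t^0$, $Y_{j,k}=Y_{\alpha_j+\cdots+\alpha_k}$ ($1\le j\le k\le n$), $Y_j=Y_{j,j}$. Chevalley generators: for $1\le j\le m-1$, $\widetilde e_j=\frac12\{Y_{2j-1,2j}-Y_{2j,2j+1}-iY_{2j-1,2j+1}-iY_{2j}\}$, $\widetilde f_j=\frac12\{-Y_{2j-1,2j}+Y_{2j,2j+1}-iY_{2j-1,2j+1}-iY_{2j}\}$, $\widetilde h_j=i\{Y_{2j-1}-Y_{2j+1}\}$. For $n=2m-1$: $\widetilde e_m=\frac12\{Y_{2m-3,2m-2}+Y_{2m-2,2m-1}+iY_{2m-3,2m-1}-iY_{2m-2}\}$, $\widetilde f_m=\frac12\{-Y_{2m-3,2m-2}-Y_{2m-2,2m-1}+iY_{2m-3,2m-1}-iY_{2m-2}\}$, $\widetilde h_m=i\{Y_{2m-3}+Y_{2m-1}\}$. For $n=2m$: $\widetilde e_m=Y_{2m-2,2m-1}-iY_{2m-2}$,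 $\widetilde f_m=-Y_{2m-2,2m-1}-iY_{2m-2}$, $\widetilde h_m=2iY_{2m-1}$. $\widetilde e_0=\frac12\{i(X_{\alpha_1}-X_{-\alpha_1})+H_{\alpha_1}\}\otimes t$, $\widetilde f_0=\frac12\{-i(X_{\alpha_1}-X_{-\alpha_1})+H_{\alpha_1}\}\otimes t^{-1}$, $\widetilde h_0=-iY_{\alpha_1}+\frac K2$. A singular vector is a nonzero weight vector annihilated by all $\widetilde e_j$ ($0\le j\le m$). $\widetilde\Lambda_j$ are the fundamental weights dual to the simple coroots $\widetilde h_j$: a vector has weight $\widetilde\Lambda_j$ if $\widetilde h_j$ acts on it by $1$ and all other $\widetilde h_k$ by $0$. *)

theory Defs
  imports Complex_Main "HOL-Library.Poly_Mapping" "HOL-Library.Z2"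
begin

section \<open>Complex vector spaces with a given basis\<close>

text \<open>
  All complex vector spaces below are (subspaces of) free vector spaces
  \<open>'a \<Rightarrow>\<^sub>0 complex\<close> on a set of basis vectors \<open>Poly_Mapping.single a 1\<close>.
\<close>

abbreviation keys :: "('a \<Rightarrow>\<^sub>0 'b::zero) \<Rightarrow> 'a set" where "keys \<equiv> Poly_Mapping.keys"
abbreviation lookup :: "('a \<Rightarrow>\<^sub>0 'b::zero) \<Rightarrow> 'a \<Rightarrow> 'b" where "lookup \<equiv> Poly_Mapping.lookup"

definition smul :: "complex \<Rightarrow> ('a \<Rightarrow>\<^sub>0 complex) \<Rightarrow> ('a \<Rightarrow>\<^sub>0 complex)" where
  "smul c x = Poly_Mapping.map ((*) c) x"

lemma lookup_smul [simp]: "lookup (smul c x) a = c * lookup x a"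
  by (simp add: smul_def Poly_Mapping.map.rep_eq when_def)

global_interpretation cvs: vector_space "smul :: complex \<Rightarrow> ('a \<Rightarrow>\<^sub>0 complex) \<Rightarrow> _"
  by unfold_locales (simp_all add: poly_mapping_eq_iff fun_eq_iff lookup_add algebra_simps)

definition linext :: "('a \<Rightarrow> 'b \<Rightarrow>\<^sub>0 complex) \<Rightarrow> ('a \<Rightarrow>\<^sub>0 complex) \<Rightarrow> ('b \<Rightarrow>\<^sub>0 complex)" where
  "linext F x = (\<Sum>a\<in>keys x. smul (lookup x a) (F a))"

definition bilext :: "('a \<Rightarrow> 'b \<Rightarrow> 'c \<Rightarrow>\<^sub>0 complex) \<Rightarrow> ('a \<Rightarrow>\<^sub>0 complex) \<Rightarrow> ('b \<Rightarrow>\<^sub>0 complex)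
    \<Rightarrow> ('c \<Rightarrow>\<^sub>0 complex)" where
  "bilext F x y = (\<Sum>a\<in>keys x. \<Sum>b\<in>keys y. smul (lookup x a * lookup y b) (F a b))"

text \<open>The tensor product of the free spaces on \<open>'a\<close> and \<open>'b\<close> is the free space on \<open>'a \<times> 'b\<close>.\<close>

definition tens :: "('a \<Rightarrow>\<^sub>0 complex) \<Rightarrow> ('b \<Rightarrow>\<^sub>0 complex) \<Rightarrow> ('a \<times> 'b \<Rightarrow>\<^sub>0 complex)" where
  "tens u f = bilext (\<lambda>a b. Poly_Mapping.single (a, b) 1) u f"

definition tensor_space :: "('a \<Rightarrow>\<^sub>0 complex) set \<Rightarrow> ('b \<Rightarrow>\<^sub>0 complex) set \<Rightarrow> ('a \<times> 'b \<Rightarrow>\<^sub>0 complex) set" where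
  "tensor_space U P = cvs.span {tens u f | u f. u \<in> U \<and> f \<in> P}"


section \<open>Lie algebra modules\<close>

text \<open>
  A Lie algebra is given by a subspace \<open>L\<close> of a free vector space and a bracket \<open>br\<close>;
  a module by a subspace \<open>W\<close> and an action \<open>\<rho>\<close>, relevant only for arguments in \<open>L\<close> and \<open>W\<close>.
\<close>

definition lie_module ::
  "('a \<Rightarrow>\<^sub>0 complex) set \<Rightarrow> (('a \<Rightarrow>\<^sub>0 complex) \<Rightarrow> ('a \<Rightarrow>\<^sub>0 complex) \<Rightarrow> ('a \<Rightarrow>\<^sub>0 complex)) \<Rightarrow>
   (('a \<Rightarrow>\<^sub>0 complex) \<Rightarrow> ('b \<Rightarrow>\<^sub>0 complex) \<Rightarrow> ('b \<Rightarrow>\<^sub>0 complex)) \<Rightarrow> ('b \<Rightarrow>\<^sub>0 complex) set \<Rightarrow> bool" where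
  "lie_module L br \<rho> W \<longleftrightarrow>
     cvs.subspace W \<and>
     (\<forall>x\<in>L. \<forall>v\<in>W. \<rho> x v \<in> W) \<and>
     (\<forall>x\<in>L. \<forall>v\<in>W. \<forall>w\<in>W. \<rho> x (v + w) = \<rho> x v + \<rho> x w) \<and>
     (\<forall>x\<in>L. \<forall>c. \<forall>v\<in>W. \<rho> x (smul c v) = smul c (\<rho> x v)) \<and>
     (\<forall>x\<in>L. \<forall>y\<in>L. \<forall>v\<in>W. \<rho> (x + y) v = \<rho> x v + \<rho> y v) \<and>
     (\<forall>x\<in>L. \<forall>c. \<forall>v\<in>W. \<rho> (smul c x) v = smul c (\<rho> x v)) \<and>
     (\<forall>x\<in>L. \<forall>y\<in>L. \<forall>v\<in>W. \<rho> (br x y) v = \<rho> x (\<rho> y v) - \<rho> y (\<rho> x v))"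

definition submodule ::
  "('a \<Rightarrow>\<^sub>0 complex) set \<Rightarrow> (('a \<Rightarrow>\<^sub>0 complex) \<Rightarrow> ('b \<Rightarrow>\<^sub>0 complex) \<Rightarrow> ('b \<Rightarrow>\<^sub>0 complex)) \<Rightarrow>
   ('b \<Rightarrow>\<^sub>0 complex) set \<Rightarrow> ('b \<Rightarrow>\<^sub>0 complex) set \<Rightarrow> bool" where
  "submodule L \<rho> W M \<longleftrightarrow> cvs.subspace M \<and> M \<subseteq> W \<and> (\<forall>x\<in>L. \<forall>v\<in>M. \<rho> x v \<in> M)"

definition irreducible_module ::
  "('a \<Rightarrow>\<^sub>0 complex) set \<Rightarrow> (('a \<Rightarrow>\<^sub>0 complex) \<Rightarrow> ('a \<Rightarrow>\<^sub>0 complex) \<Rightarrow> ('a \<Rightarrow>\<^sub>0 complex)) \<Rightarrow>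
   (('a \<Rightarrow>\<^sub>0 complex) \<Rightarrow> ('b \<Rightarrow>\<^sub>0 complex) \<Rightarrow> ('b \<Rightarrow>\<^sub>0 complex)) \<Rightarrow> ('b \<Rightarrow>\<^sub>0 complex) set \<Rightarrow> bool" where
  "irreducible_module L br \<rho> W \<longleftrightarrow>
     lie_module L br \<rho> W \<and> W \<noteq> {0} \<and> (\<forall>M. submodule L \<rho> W M \<longrightarrow> M = {0} \<or> M = W)"


section \<open>The root system of type \<open>A\<^sub>n\<close>\<close>

text \<open>
  An element of the root lattice \<open>Q\<close> is its coefficient family with respect to the simple
  roots \<open>\<alpha>\<^sub>1, \<dots>, \<alpha>\<^sub>n\<close>, i.e. a \<open>nat \<Rightarrow>\<^sub>0 int\<close> supported in \<open>{1..n}\<close>.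
\<close>

type_synonym lat = "nat \<Rightarrow>\<^sub>0 int"

definition root_lattice :: "nat \<Rightarrow> lat set" where
  "root_lattice n = {\<alpha>. keys \<alpha> \<subseteq> {1..n}}"

definition simple_root :: "nat \<Rightarrow> lat" where
  "simple_root j = Poly_Mapping.single j 1"

definition chain_root :: "nat \<Rightarrow> nat \<Rightarrow> lat" where
  "chain_root j k = (\<Sum>l = j..k. simple_root l)"

definition roots :: "nat \<Rightarrow> lat set" where
  "roots n = {chain_root j k | j k. 1 \<le> j \<and> j \<le> k \<and> k \<le> n} \<union>
             {- chain_root j k | j k. 1 \<le> j \<and> j \<le> k \<and> k \<le> n}"

definition cartan_entry :: "nat \<Rightarrow> nat \<Rightarrow> int" where
  "cartan_entry j k = (if j = k then 2 else if j = Suc k \<or> k = Suc j then -1 else 0)"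

definition lat_form :: "lat \<Rightarrow> lat \<Rightarrow> int" where
  "lat_form \<alpha> \<beta> = (\<Sum>j\<in>keys \<alpha>. \<Sum>k\<in>keys \<beta>. lookup \<alpha> j * lookup \<beta> k * cartan_entry j k)"

definition nu_simple :: "nat \<Rightarrow> nat \<Rightarrow> complex" where
  "nu_simple j k =
     (if j = k \<or> ((j = Suc k \<or> k = Suc j) \<and> even j) then -1 else 1)"

definition nu :: "lat \<Rightarrow> lat \<Rightarrow> complex" where
  "nu \<alpha> \<beta> = (\<Prod>j\<in>keys \<alpha>. \<Prod>k\<in>keys \<beta>. nu_simple j k powi (lookup \<alpha> j * lookup \<beta> k))"


section \<open>The simple Lie algebra of type \<open>A\<^sub>n\<close>\<close>

text \<open>\<open>Hb j\<close> stands for the basis vector \<open>H\<close> at \<open>\<alpha>\<^sub>j\<close> and \<open>Xb \<alpha>\<close> for the root vector \<open>X\<close> at \<open>\<alpha>\<close>.\<close>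

datatype gbasis = Hb nat | Xb lat

type_synonym galg = "gbasis \<Rightarrow>\<^sub>0 complex"

definition Hvec :: "lat \<Rightarrow> galg" where
  "Hvec \<alpha> = (\<Sum>j\<in>keys \<alpha>. Poly_Mapping.single (Hb j) (of_int (lookup \<alpha> j)))"

definition Xvec :: "lat \<Rightarrow> galg" where
  "Xvec \<alpha> = Poly_Mapping.single (Xb \<alpha>) 1"

definition cartan :: "nat \<Rightarrow> galg set" where
  "cartan n = {x. keys x \<subseteq> Hb ` {1..n}}"

definition galg_carrier :: "nat \<Rightarrow> galg set" where
  "galg_carrier n = {x. keys x \<subseteq> Hb ` {1..n} \<union> Xb ` roots n}"

fun g_bracket_basis :: "nat \<Rightarrow> gbasis \<Rightarrow> gbasis \<Rightarrow> galg" where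
  "g_bracket_basis n (Hb j) (Hb k) = 0"
| "g_bracket_basis n (Hb j) (Xb \<beta>) = smul (of_int (lat_form (simple_root j) \<beta>)) (Xvec \<beta>)"
| "g_bracket_basis n (Xb \<alpha>) (Hb k) = smul (- of_int (lat_form (simple_root k) \<alpha>)) (Xvec \<alpha>)"
| "g_bracket_basis n (Xb \<alpha>) (Xb \<beta>) =
     (if \<alpha> + \<beta> \<in> roots n then smul (nu \<alpha> \<beta>) (Xvec (\<alpha> + \<beta>))
      else if \<beta> = - \<alpha> then - Hvec \<alpha> else 0)"

definition g_bracket :: "nat \<Rightarrow> galg \<Rightarrow> galg \<Rightarrow> galg" where
  "g_bracket n = bilext (g_bracket_basis n)"

text \<open>
  The value at a pair of opposite root vectors is forced by invariance and by the bracket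
  \<open>[X\<^sub>\<alpha>, X\<^sub>-\<^sub>\<alpha>] = - H\<^sub>\<alpha>\<close>.
\<close>

fun g_form_basis :: "gbasis \<Rightarrow> gbasis \<Rightarrow> complex" where
  "g_form_basis (Hb j) (Hb k) = of_int (cartan_entry j k)"
| "g_form_basis (Hb j) (Xb \<beta>) = 0"
| "g_form_basis (Xb \<alpha>) (Hb k) = 0"
| "g_form_basis (Xb \<alpha>) (Xb \<beta>) = (if \<beta> = - \<alpha> then -1 else 0)"

definition g_form :: "galg \<Rightarrow> galg \<Rightarrow> complex" where
  "g_form x y = (\<Sum>a\<in>keys x. \<Sum>b\<in>keys y. lookup x a * lookup y b * g_form_basis a b)"

fun sigma_basis :: "gbasis \<Rightarrow> galg" where
  "sigma_basis (Hb j) = - Poly_Mapping.single (Hb j) 1"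
| "sigma_basis (Xb \<alpha>) = Xvec (- \<alpha>)"

definition sigma :: "galg \<Rightarrow> galg" where
  "sigma = linext sigma_basis"

definition g_graded :: "nat \<Rightarrow> int \<Rightarrow> galg set" where
  "g_graded n j = {x \<in> galg_carrier n. sigma x = smul ((-1) powi j) x}"

definition orthonormal_basis :: "nat \<Rightarrow> (nat \<Rightarrow> galg) \<Rightarrow> bool" where
  "orthonormal_basis n S \<longleftrightarrow>
     (\<forall>j\<in>{1..n}. S j \<in> cartan n) \<and>
     (\<forall>j\<in>{1..n}. \<forall>k\<in>{1..n}. g_form (S j) (S k) = (if j = k then 1 else 0)) \<and>
     cvs.span (S ` {1..n}) = cartan n"


section \<open>The twisted affine algebra\<close>

text \<open>\<open>Loop a j\<close> stands for \<open>a \<otimes> t\<^sup>j\<close>, \<open>Kb\<close> for the central element, \<open>Db\<close> for the derivation \<open>d\<close>.\<close>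

datatype ghat_basis = Loop gbasis int | Kb | Db

type_synonym ghat = "ghat_basis \<Rightarrow>\<^sub>0 complex"

definition Kvec :: ghat where "Kvec = Poly_Mapping.single Kb 1"
definition Dvec :: ghat where "Dvec = Poly_Mapping.single Db 1"

definition loop :: "galg \<Rightarrow> int \<Rightarrow> ghat" where
  "loop x j = linext (\<lambda>a. Poly_Mapping.single (Loop a j) 1) x"

fun ghat_bracket_basis :: "nat \<Rightarrow> ghat_basis \<Rightarrow> ghat_basis \<Rightarrow> ghat" where
  "ghat_bracket_basis n (Loop a j) (Loop b k) =
     loop (g_bracket_basis n a b) (j + k) +
     (if j + k = 0 then smul (of_int j / 2 * g_form_basis a b) Kvec else 0)"
| "ghat_bracket_basis n Db (Loop b k) = smul (of_int k) (Poly_Mapping.single (Loop b k) 1)"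
| "ghat_bracket_basis n (Loop a j) Db = smul (- of_int j) (Poly_Mapping.single (Loop a j) 1)"
| "ghat_bracket_basis n _ _ = 0"

definition ghat_bracket :: "nat \<Rightarrow> ghat \<Rightarrow> ghat \<Rightarrow> ghat" where
  "ghat_bracket n = bilext (ghat_bracket_basis n)"

definition ghat_carrier :: "nat \<Rightarrow> ghat set" where
  "ghat_carrier n = cvs.span ({loop x j | x j. x \<in> g_graded n j} \<union> {Kvec, Dvec})"


section \<open>The space \<open>V\<close>\<close>

text \<open>
  \<open>Q/2Q\<close> is modelled by coefficient families modulo 2, \<open>red\<close> being the projection of \<open>Q\<close>.
  The type \<open>lat2 \<Rightarrow>\<^sub>0 complex\<close> with its convolution product is the group algebra, and
  \<open>nat \<times> nat \<Rightarrow>\<^sub>0 nat\<close> is the type of monomials in the variables \<open>x\<close> with pairs \<open>(j, r)\<close> of indices.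
\<close>

type_synonym lat2 = "nat \<Rightarrow>\<^sub>0 bit"
type_synonym grpalg = "lat2 \<Rightarrow>\<^sub>0 complex"
type_synonym pol = "(nat \<times> nat \<Rightarrow>\<^sub>0 nat) \<Rightarrow>\<^sub>0 complex"
type_synonym fock = "lat2 \<times> (nat \<times> nat \<Rightarrow>\<^sub>0 nat) \<Rightarrow>\<^sub>0 complex"

definition red :: "lat \<Rightarrow> lat2" where
  "red \<alpha> = Poly_Mapping.map of_int \<alpha>"

lemma lookup_red [simp]: "lookup (red \<alpha>) j = of_int (lookup \<alpha> j)"
  by (simp add: red_def Poly_Mapping.map.rep_eq when_def)

lemma red_add: "red (\<alpha> + \<beta>) = red \<alpha> + red \<beta>"
  by (simp add: poly_mapping_eq_iff fun_eq_iff lookup_add)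

lemma of_int_bit: "(of_int k :: bit) = of_bool (odd k)"
proof (cases "even k")
  case True
  then obtain l where "k = 2 * l" ..
  then show ?thesis by (simp only: of_int_mult of_int_numeral bit_2_eq_0) simp
next
  case False
  then obtain l where "k = 2 * l + 1" by (elim oddE)
  then show ?thesis
    by (simp only: of_int_add of_int_mult of_int_numeral bit_2_eq_0 of_int_1) simp
qed

lemma red_eq_iff: "red \<alpha> = red \<beta> \<longleftrightarrow> (\<exists>\<delta>. \<alpha> = \<beta> + \<delta> + \<delta>)"
proof
  assume eq: "red \<alpha> = red \<beta>"
  have ev: "even (lookup \<alpha> j - lookup \<beta> j)" for j
  proof -
    have "lookup (red \<alpha>) j = lookup (red \<beta>) j" by (simp only: eq)
    then show ?thesis by (cases "even (lookup \<alpha> j)"; cases "even (lookup \<beta> j)") (simp_all add: of_int_bit)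
  qed
  define \<delta> where "\<delta> = Poly_Mapping.map (\<lambda>k. k div 2) (\<alpha> - \<beta>)"
  have \<delta>: "lookup \<delta> j = (lookup \<alpha> j - lookup \<beta> j) div 2" for j
    by (simp add: \<delta>_def Poly_Mapping.map.rep_eq when_def lookup_minus)
  have "lookup \<alpha> j = lookup (\<beta> + \<delta> + \<delta>) j" for j
    unfolding lookup_add \<delta> using ev[of j] by presburger
  then have "\<alpha> = \<beta> + \<delta> + \<delta>" by (intro poly_mapping_eqI)
  then show "\<exists>\<delta>. \<alpha> = \<beta> + \<delta> + \<delta>" ..
next
  assume "\<exists>\<delta>. \<alpha> = \<beta> + \<delta> + \<delta>"
  then obtain \<delta> where \<delta>: "\<alpha> = \<beta> + \<delta> + \<delta>" ..
  show "red \<alpha> = red \<beta>"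
    by (rule poly_mapping_eqI) (simp only: \<delta> lookup_red lookup_add of_int_bit, simp)
qed

definition gexp :: "lat2 \<Rightarrow> grpalg" where
  "gexp \<gamma> = Poly_Mapping.single \<gamma> 1"

definition grpalg_carrier :: "nat \<Rightarrow> grpalg set" where
  "grpalg_carrier n = {u. \<forall>\<gamma>\<in>keys u. keys \<gamma> \<subseteq> {1..n}}"

definition pol_carrier :: "nat \<Rightarrow> pol set" where
  "pol_carrier n = {f. \<forall>M\<in>keys f. keys M \<subseteq> {1..n} \<times> {r. odd r}}"

definition fock_carrier :: "nat \<Rightarrow> fock set" where
  "fock_carrier n = tensor_space (grpalg_carrier n) (pol_carrier n)"

definition vac :: "nat \<Rightarrow> (nat \<Rightarrow> complex) \<Rightarrow> grpalg" where
  "vac n c = (\<Prod>j = 1..n. 1 + smul (\<i> * c j) (gexp (red (simple_root j))))"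

definition xvar :: "nat \<Rightarrow> nat \<Rightarrow> pol" where
  "xvar j r = Poly_Mapping.single (Poly_Mapping.single (j, r) 1) 1"

definition pdiff :: "nat \<Rightarrow> nat \<Rightarrow> pol \<Rightarrow> pol" where
  "pdiff j r = linext (\<lambda>M. smul (of_nat (lookup M (j, r)))
     (Poly_Mapping.single (M - Poly_Mapping.single (j, r) 1) 1))"


section \<open>Vertex operators\<close>

text \<open>
  For operators \<open>A 1, A 2, \<dots>\<close>, the operators \<open>ser_pow A N p\<close> and \<open>ser_exp A p\<close> are the coefficients
  of \<open>y\<^sup>p\<close> in the \<open>N\<close>-th power and in the exponential of the formal series
  \<open>\<Sum>\<^bsub>r\<ge>1\<^esub> A r y\<^sup>r\<close>; as there is no constant term, only the powers \<open>N \<le> p\<close> contribute to the latter.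
\<close>

fun ser_pow :: "(nat \<Rightarrow> pol \<Rightarrow> pol) \<Rightarrow> nat \<Rightarrow> nat \<Rightarrow> pol \<Rightarrow> pol" where
  "ser_pow A 0 p f = (if p = 0 then f else 0)"
| "ser_pow A (Suc N) p f = (\<Sum>r = 1..p. A r (ser_pow A N (p - r) f))"

definition ser_exp :: "(nat \<Rightarrow> pol \<Rightarrow> pol) \<Rightarrow> nat \<Rightarrow> pol \<Rightarrow> pol" where
  "ser_exp A p f = (\<Sum>N\<le>p. smul (1 / fact N) (ser_pow A N p f))"

text \<open>Here \<open>(\<alpha>|S\<^sub>j)\<close> is computed with the element \<open>H\<^sub>\<alpha>\<close> of the Cartan subalgebra identified with \<open>\<alpha>\<close>.\<close>

definition lam :: "(nat \<Rightarrow> galg) \<Rightarrow> lat \<Rightarrow> nat \<Rightarrow> complex" where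
  "lam S \<alpha> j = of_real (sqrt 2) * g_form (Hvec \<alpha>) (S j)"

text \<open>Coefficients of \<open>z\<^sup>r\<close>, respectively \<open>z\<^sup>-\<^sup>r\<close>, in the exponents of the two exponentials.\<close>

definition creat :: "nat \<Rightarrow> (nat \<Rightarrow> galg) \<Rightarrow> lat \<Rightarrow> nat \<Rightarrow> pol \<Rightarrow> pol" where
  "creat n S \<alpha> r f = (if odd r then \<Sum>j = 1..n. smul (lam S \<alpha> j) (xvar j r * f) else 0)"

definition annih :: "nat \<Rightarrow> (nat \<Rightarrow> galg) \<Rightarrow> lat \<Rightarrow> nat \<Rightarrow> pol \<Rightarrow> pol" where
  "annih n S \<alpha> r f = (if odd r then - (\<Sum>j = 1..n. smul (lam S \<alpha> j / of_nat r) (pdiff j r f)) else 0)"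

text \<open>
  The coefficient of \<open>z\<^sup>k\<close> in \<open>exp(\<Sum> \<lambda>\<^sub>j x z\<^sup>r) exp(- \<Sum> \<lambda>\<^sub>j z\<^sup>-\<^sup>r/r \<partial>/\<partial>x) f\<close>. Only finitely many
  summands are nonzero, because \<open>ser_exp (annih n S \<alpha>) q f\<close> vanishes when \<open>q\<close> exceeds the weighted
  degree of the polynomial \<open>f\<close>.
\<close>

definition vertex_coeff :: "nat \<Rightarrow> (nat \<Rightarrow> galg) \<Rightarrow> lat \<Rightarrow> int \<Rightarrow> pol \<Rightarrow> pol" where
  "vertex_coeff n S \<alpha> k f =
     Sum_any (\<lambda>q::nat. if 0 \<le> k + int q
       then ser_exp (creat n S \<alpha>) (nat (k + int q)) (ser_exp (annih n S \<alpha>) q f) else 0)"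

text \<open>The coefficient of \<open>z\<^sup>-\<^sup>r\<^sup>-\<^sup>1\<close> in \<open>a\<^sup>(\<^sup>j\<^sup>)(z)\<close>, for odd \<open>r\<close>.\<close>

definition heis :: "nat \<Rightarrow> int \<Rightarrow> pol \<Rightarrow> pol" where
  "heis j r f = (if r > 0 then pdiff j (nat r) f
                 else smul (of_nat (nat (- r))) (xvar j (nat (- r)) * f))"

definition euler :: "nat \<Rightarrow> pol \<Rightarrow> pol" where
  "euler n f = (\<Sum>j = 1..n. Sum_any (\<lambda>r::nat.
     if odd r then smul (of_nat r) (xvar j r * pdiff j r f) else 0))"

text \<open>
  \<open>\<rho>\<close> is the action of the twisted affine algebra on \<open>V\<close> prescribed by the vertex operators.
  The operators are given on \<open>e\<^sup>\<gamma> \<otimes> f\<close>, which span \<open>V\<close>, with \<open>\<gamma>\<close> represented by a lattice vector.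
\<close>

definition affine_action ::
  "nat \<Rightarrow> (nat \<Rightarrow> galg) \<Rightarrow> (ghat \<Rightarrow> fock \<Rightarrow> fock) \<Rightarrow> bool" where
  "affine_action n S \<rho> \<longleftrightarrow>
     lie_module (ghat_carrier n) (ghat_bracket n) \<rho> (fock_carrier n) \<and>
     (\<forall>\<gamma>\<in>root_lattice n. \<forall>f\<in>pol_carrier n.
        (\<forall>\<alpha>\<in>roots n. \<forall>j::int.
           \<rho> (loop (Xvec \<alpha> + smul ((-1) powi j) (Xvec (- \<alpha>))) j) (tens (gexp (red \<gamma>)) f) =
           smul (1/2 * nu \<alpha> \<gamma>) (tens (gexp (red (\<alpha> + \<gamma>))) (vertex_coeff n S \<alpha> (- j) f))) \<and>
        (\<forall>H\<in>cartan n. \<forall>j::int. odd j \<longrightarrow>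
           \<rho> (loop H j) (tens (gexp (red \<gamma>)) f) =
           tens (gexp (red \<gamma>))
             (smul (1 / of_real (sqrt 2)) (\<Sum>k = 1..n. smul (g_form H (S k)) (heis k j f)))) \<and>
        \<rho> Kvec (tens (gexp (red \<gamma>)) f) = tens (gexp (red \<gamma>)) f \<and>
        \<rho> Dvec (tens (gexp (red \<gamma>)) f) = tens (gexp (red \<gamma>)) (- euler n f))"


section \<open>Chevalley generators, singular vectors and weights\<close>

definition Y :: "lat \<Rightarrow> ghat" where
  "Y \<alpha> = loop (Xvec \<alpha> + Xvec (- \<alpha>)) 0"

definition Yc :: "nat \<Rightarrow> nat \<Rightarrow> ghat" where
  "Yc j k = Y (chain_root j k)"

text \<open>Here \<open>n\<close> is \<open>2 * m - 1\<close> or \<open>2 * m\<close>, and \<open>0 \<le> j \<le> m\<close>.\<close>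

definition chev_e :: "nat \<Rightarrow> nat \<Rightarrow> nat \<Rightarrow> ghat" where
  "chev_e n m j =
     (if j = 0 then
        loop (smul (1/2) (smul \<i> (Xvec (simple_root 1) - Xvec (- simple_root 1))
                          + Hvec (simple_root 1))) 1
      else if j < m then
        smul (1/2) (Yc (2*j-1) (2*j) - Yc (2*j) (2*j+1)
                    - smul \<i> (Yc (2*j-1) (2*j+1)) - smul \<i> (Yc (2*j) (2*j)))
      else if n = 2*m then
        Yc (2*m-2) (2*m-1) - smul \<i> (Yc (2*m-2) (2*m-2))
      else
        smul (1/2) (Yc (2*m-3) (2*m-2) + Yc (2*m-2) (2*m-1)
                    + smul \<i> (Yc (2*m-3) (2*m-1)) - smul \<i> (Yc (2*m-2) (2*m-2))))"

definition chev_h :: "nat \<Rightarrow> nat \<Rightarrow> nat \<Rightarrow> ghat" where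
  "chev_h n m j =
     (if j = 0 then smul (- \<i>) (Y (simple_root 1)) + smul (1/2) Kvec
      else if j < m then smul \<i> (Yc (2*j-1) (2*j-1) - Yc (2*j+1) (2*j+1))
      else if n = 2*m then smul (2 * \<i>) (Yc (2*m-1) (2*m-1))
      else smul \<i> (Yc (2*m-3) (2*m-3) + Yc (2*m-1) (2*m-1)))"

text \<open>The Cartan subalgebra of the affine algebra is spanned by the coroots and \<open>d\<close>.\<close>

definition weight_vector :: "nat \<Rightarrow> nat \<Rightarrow> (ghat \<Rightarrow> fock \<Rightarrow> fock) \<Rightarrow> fock \<Rightarrow> bool" where
  "weight_vector n m \<rho> v \<longleftrightarrow>
     v \<in> fock_carrier n \<and> v \<noteq> 0 \<and>
     (\<forall>h \<in> chev_h n m ` {0..m} \<union> {Dvec}. \<exists>\<mu>. \<rho> h v = smul \<mu> v)"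

definition singular_vector :: "nat \<Rightarrow> nat \<Rightarrow> (ghat \<Rightarrow> fock \<Rightarrow> fock) \<Rightarrow> fock \<Rightarrow> bool" where
  "singular_vector n m \<rho> v \<longleftrightarrow>
     weight_vector n m \<rho> v \<and> (\<forall>j\<in>{0..m}. \<rho> (chev_e n m j) v = 0)"

definition has_fundamental_weight ::
  "nat \<Rightarrow> nat \<Rightarrow> (ghat \<Rightarrow> fock \<Rightarrow> fock) \<Rightarrow> nat \<Rightarrow> fock \<Rightarrow> bool" where
  "has_fundamental_weight n m \<rho> p v \<longleftrightarrow>
     (\<forall>j\<in>{0..m}. \<rho> (chev_h n m j) v = smul (if j = p then 1 else 0) v)"

definition irreducible_highest_weight_module ::
  "nat \<Rightarrow> nat \<Rightarrow> (ghat \<Rightarrow> fock \<Rightarrow> fock) \<Rightarrow> fock set \<Rightarrow> fock \<Rightarrow> bool" where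
  "irreducible_highest_weight_module n m \<rho> W v \<longleftrightarrow>
     irreducible_module (ghat_carrier n) (ghat_bracket n) \<rho> W \<and>
     v \<in> W \<and> singular_vector n m \<rho> v \<and>
     (\<forall>M. submodule (ghat_carrier n) \<rho> W M \<and> v \<in> M \<longrightarrow> M = W)"

definition sign_family :: "nat \<Rightarrow> (nat \<Rightarrow> complex) \<Rightarrow> bool" where
  "sign_family n c \<longleftrightarrow> (\<forall>j\<in>{1..n}. c j \<in> {1, -1})"

end

theory Submission
  imports Defs
begin

text \<open>
  On the constant polynomials the zero modes \<open>Y\<^sub>\<alpha>\<close> act through the group algebra alone, namely
  by half of the twisted translation \<open>e\<^sup>\<gamma> \<mapsto> \<nu>(\<alpha>,\<gamma>) e\<^sup>\<alpha>\<^sup>+\<^sup>\<gamma>\<close> of the group algebra.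
  As \<open>v(c)\<close> is a product over the simple roots and \<open>e\<close> to the power \<open>2\<alpha>\<^sub>l\<close> is \<open>1\<close>, each factor
  \<open>1 + i c\<^sub>l e\<close> is reproduced up to a scalar and a sign of \<open>c\<^sub>l\<close>. So a twisted
  translation sends \<open>v(c)\<close> to a nonzero multiple of \<open>v(c')\<close>, and for the particular cocycle \<open>\<nu>\<close>
  the rule is that even signs never change while \<open>c\<^sub>l\<close> with odd \<open>l\<close> changes exactly if the
  coefficients of \<open>\<alpha>\<close> at \<open>l - 1\<close> and \<open>l + 1\<close> have odd sum (\<open>twisted_translation_vac\<close>).

  In other words, the odd signs are, up to a factor \<open>1/2\<close>, the weights of a spin representation,
  with \<open>v(c)\<close> an eigenvector of the \<open>Y\<^sub>j\<close> for odd \<open>j\<close>, and with \<open>Y\<^sub>2\<^sub>j\<close> flipping the neighbouring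
  odd signs. All root chains in \<open>e\<^sub>j\<close> for \<open>j \<ge> 1\<close> pass through a single even index and hence flip the same
  pair of signs, so that \<open>e\<^sub>j v(c)\<close> is a multiple of one vector \<open>v(c')\<close>. The multiples factor into terms
  such as \<open>(c\<^sub>2\<^sub>j\<^sub>-\<^sub>1 - 1)(c\<^sub>2\<^sub>j\<^sub>+\<^sub>1 + 1)\<close>, from which the singular vectors and their weights are read off
  (\<open>singular_vector_vac_iff\<close>, \<open>chev_h_vac\<close>).

  For the irreducibility let \<open>W\<close> be the tensor product with the polynomials of the span of the
  \<open>v(b)\<close>, where \<open>b\<close> runs through a set \<open>B\<close> of sign families closed under the flips; the flip rule
  makes \<open>W\<close> invariant. A nonzero submodule of \<open>W\<close> contains a nonzero element without variables,
  because \<open>S\<^sub>k \<otimes> t\<^sup>r\<close> with \<open>r > 0\<close> differentiates. Splitting it into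
  eigenvectors of the \<open>Y\<^sub>j\<close> with odd \<open>j\<close> yields some \<open>v(b)\<close>; the flips by even simple roots reach every other
  \<open>v(b')\<close> with \<open>b'\<close> in \<open>B\<close>; and \<open>S\<^sub>k \<otimes> t\<^sup>-\<^sup>r\<close> multiplies by variables, so the submodule is all of \<open>W\<close>. The two
  parts of the theorem differ only in \<open>B\<close>: for odd \<open>n\<close> the flips come in pairs and preserve the
  product of the odd signs, whereas for even \<open>n\<close> the root \<open>\<alpha>\<^sub>n\<close> flips the last odd sign alone.
\<close>

section \<open>Linear algebra of free vector spaces\<close>

lemma sum_smul_single:
  assumes "finite A" "keys x \<subseteq> A"
  shows "x = (\<Sum>a\<in>A. smul (lookup x a) (Poly_Mapping.single a 1))"
proof (rule poly_mapping_eqI)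
  fix k
  have "lookup (\<Sum>a\<in>A. smul (lookup x a) (Poly_Mapping.single a 1)) k
      = (\<Sum>a\<in>A. if a = k then lookup x a else 0)"
    by (simp add: lookup_sum lookup_single when_def if_distrib cong: if_cong)
  also have "\<dots> = lookup x k"
    using assms by (auto simp: sum.delta in_keys_iff subset_iff)
  finally show "lookup x k = lookup (\<Sum>a\<in>A. smul (lookup x a) (Poly_Mapping.single a 1)) k" ..
qed

lemma linext_eq_sum:
  assumes "finite A" "keys x \<subseteq> A"
  shows "linext F x = (\<Sum>a\<in>A. smul (lookup x a) (F a))"
  unfolding linext_def
  by (rule sum.mono_neutral_left) (use assms in \<open>auto simp: in_keys_iff\<close>)

lemma linext_add: "linext F (x + y) = linext F x + linext F y"
proof -
  let ?A = "keys x \<union> keys y"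
  have "keys (x + y) \<subseteq> ?A" by (rule keys_add)
  then show ?thesis
    by (simp add: linext_eq_sum[of ?A] lookup_add cvs.scale_left_distrib sum.distrib)
qed

lemma linext_smul: "linext F (smul c x) = smul c (linext F x)"
proof -
  have "keys (smul c x) \<subseteq> keys x" by (auto simp: in_keys_iff)
  then show ?thesis
    by (simp add: linext_eq_sum[of "keys x"] cvs.scale_sum_right)
qed

lemma linext_single [simp]: "linext F (Poly_Mapping.single a c) = smul c (F a)"
  by (simp add: linext_eq_sum[of "{a}"])

lemma linext_0 [simp]: "linext F 0 = 0"
  by (simp add: linext_def)

lemma lookup_tens [simp]: "lookup (tens u f) (a, b) = lookup u a * lookup f b"
proof -
  have "lookup (tens u f) (a, b)
      = (\<Sum>a'\<in>keys u. \<Sum>b'\<in>keys f. if a' = a then if b' = b then lookup u a' * lookup f b' else 0 else 0)"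
    unfolding tens_def bilext_def
    by (auto simp: lookup_sum lookup_single when_def intro!: sum.cong)
  also have "\<dots> = (\<Sum>a'\<in>keys u. if a' = a then lookup u a * lookup f b else 0)"
    by (rule sum.cong) (auto simp: in_keys_iff sum.delta)
  also have "\<dots> = lookup u a * lookup f b"
    by (auto simp: in_keys_iff sum.delta)
  finally show ?thesis .
qed

lemma tens_bilinear:
  "tens (u + v) f = tens u f + tens v f" "tens u (f + g) = tens u f + tens u g"
  "tens (smul c u) f = smul c (tens u f)" "tens u (smul c f) = smul c (tens u f)"
  "tens 0 f = 0" "tens u 0 = 0"
  by (rule poly_mapping_eqI; clarsimp simp: lookup_add algebra_simps)+

lemma tens_sum_left: "tens (\<Sum>i\<in>I. u i) f = (\<Sum>i\<in>I. tens (u i) f)"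
  by (induction I rule: infinite_finite_induct) (simp_all add: tens_bilinear)

lemma tens_sum_right: "tens u (\<Sum>i\<in>I. f i) = (\<Sum>i\<in>I. tens u (f i))"
  by (induction I rule: infinite_finite_induct) (simp_all add: tens_bilinear)

lemma tens_in_tensor_space: "u \<in> U \<Longrightarrow> f \<in> P \<Longrightarrow> tens u f \<in> tensor_space U P"
  unfolding tensor_space_def by (rule cvs.span_base) blast

lemma tensor_space_least:
  assumes "cvs.subspace X" "\<And>u f. u \<in> U \<Longrightarrow> f \<in> P \<Longrightarrow> tens u f \<in> X"
  shows "tensor_space U P \<subseteq> X"
  unfolding tensor_space_def by (rule cvs.span_minimal) (use assms in auto)

lemma subspace_tensor_space: "cvs.subspace (tensor_space U P)"
  unfolding tensor_space_def by (rule cvs.subspace_span)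

lemma tensor_space_span_least:
  assumes X: "cvs.subspace X" and gen: "\<And>u f. u \<in> U \<Longrightarrow> f \<in> P \<Longrightarrow> tens u f \<in> X"
  shows "tensor_space (cvs.span U) P \<subseteq> X"
proof (rule tensor_space_least[OF X])
  fix u f assume u: "u \<in> cvs.span U" and f: "f \<in> P"
  from u show "tens u f \<in> X"
  proof (induction rule: cvs.span_induct_alt)
    case base
    then show ?case using cvs.subspace_0[OF X] by (simp add: tens_bilinear)
  next
    case (step c x y)
    then show ?case
      using gen[OF _ f] by (simp add: tens_bilinear cvs.subspace_add[OF X] cvs.subspace_scale[OF X])
  qed
qed

lemma lookup_loop [simp]:
  "lookup (loop x j) (Loop a k) = (if k = j then lookup x a else 0)"
  "lookup (loop x j) Kb = 0" "lookup (loop x j) Db = 0"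
proof -
  have "(if a' = a \<and> j = k then lookup x a' else 0) = (if a' = a then if k = j then lookup x a else 0 else 0)" for a'
    by auto
  then show "lookup (loop x j) (Loop a k) = (if k = j then lookup x a else 0)"
    unfolding loop_def linext_def
    by (simp add: lookup_sum lookup_single when_def if_distrib sum.delta in_keys_iff cong: if_cong)
qed (simp_all add: loop_def linext_def lookup_sum lookup_single)

lemma ghat_eqI:
  assumes "\<And>a k. lookup x (Loop a k) = lookup y (Loop a k)"
    "lookup x Kb = lookup y Kb" "lookup x Db = lookup y Db"
  shows "x = (y :: ghat)"
proof (rule poly_mapping_eqI)
  show "lookup x b = lookup y b" for b by (cases b) (use assms in auto)
qed

lemma loop_add: "loop (x + y) j = loop x j + loop y j"
  by (rule ghat_eqI) (simp_all add: lookup_add)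

lemma loop_smul: "loop (smul c x) j = smul c (loop x j)"
  by (rule ghat_eqI) simp_all

lemma loop_0: "loop 0 j = 0"
  by (rule ghat_eqI) simp_all

lemma loop_sum: "loop (\<Sum>i\<in>I. x i) j = (\<Sum>i\<in>I. loop (x i) j)"
  by (induction I rule: infinite_finite_induct) (simp_all add: loop_add loop_0)


section \<open>Operators on polynomials\<close>

lemma smul_mult_left: "smul c f * g = smul c (f * g :: 'a::monoid_add \<Rightarrow>\<^sub>0 complex)"
  by (simp add: smul_def mult_map_scale_conv_mult mult.assoc)

lemma smul_mult_right:
  fixes f g :: "'a::comm_monoid_add \<Rightarrow>\<^sub>0 complex"
  shows "f * smul c g = smul c (f * g)"
  using smul_mult_left[of c g f] by (simp add: mult.commute)

lemma prod_smul:
  assumes "finite A"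
  shows "(\<Prod>a\<in>A. smul (c a) (x a)) = smul (\<Prod>a\<in>A. c a) (\<Prod>a\<in>A. x a :: 'a::comm_monoid_add \<Rightarrow>\<^sub>0 complex)"
  using assms by induction (simp_all add: smul_mult_left smul_mult_right)

lemma subspace_pol_carrier: "cvs.subspace (pol_carrier n)"
proof (rule cvs.subspaceI)
  show "0 \<in> pol_carrier n" by (simp add: pol_carrier_def)
next
  fix x y assume "x \<in> pol_carrier n" "y \<in> pol_carrier n"
  then show "x + y \<in> pol_carrier n" 
    using keys_add[of x y] unfolding pol_carrier_def by blast
next
  fix c and x :: pol
  assume x: "x \<in> pol_carrier n"
  have "keys (smul c x) \<subseteq> keys x" by (auto simp: in_keys_iff)
  with x show "smul c x \<in> pol_carrier n" 
    unfolding pol_carrier_def by blast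
qed

lemma one_in_pol_carrier: "1 \<in> pol_carrier n"
  by (simp add: pol_carrier_def)

lemma single_in_pol_carrier: "keys M \<subseteq> {1..n} \<times> {r. odd r} \<Longrightarrow> Poly_Mapping.single M c \<in> pol_carrier n"
  by (simp add: pol_carrier_def)

lemma xvar_mult_in_pol_carrier:
  assumes "f \<in> pol_carrier n" "k \<in> {1..n}" "odd r"
  shows "xvar k r * f \<in> pol_carrier n"
  unfolding pol_carrier_def
proof (intro CollectI ballI subsetI)
  fix M p assume M: "M \<in> keys (xvar k r * f)" and p: "p \<in> keys M"
  obtain N where N: "N \<in> keys f" "M = Poly_Mapping.single (k, r) 1 + N"
    using M keys_mult[of "xvar k r" f] by (auto simp: xvar_def split: if_splits)
  then have "p \<in> {(k, r)} \<union> keys N"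
    using p keys_add[of "Poly_Mapping.single (k, r) 1" N] by (auto split: if_splits)
  then show "p \<in> {1..n} \<times> {r. odd r}"
    using N assms unfolding pol_carrier_def by blast
qed

lemma keys_minus_subset: "keys (M - N) \<subseteq> keys (M :: 'a \<Rightarrow>\<^sub>0 nat)"
  by (auto simp: in_keys_iff lookup_minus)

lemma pdiff_in_pol_carrier:
  assumes "f \<in> pol_carrier n"
  shows "pdiff k r f \<in> pol_carrier n"
  unfolding pdiff_def linext_def
proof (intro cvs.subspace_sum[OF subspace_pol_carrier] cvs.subspace_scale[OF subspace_pol_carrier]
    single_in_pol_carrier)
  fix M assume "M \<in> keys f"
  then show "keys (M - Poly_Mapping.single (k, r) 1) \<subseteq> {1..n} \<times> {r. odd r}"
    using assms keys_minus_subset[of M] unfolding pol_carrier_def by blast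
qed

text \<open>
  The coefficient of a monomial in the derivative comes from a single monomial with a nonzero factor;
  hence a polynomial that involves a variable does not vanish under the corresponding derivation.
\<close>

lemma lookup_pdiff:
  "lookup (pdiff k r f) M
   = of_nat (Suc (lookup M (k, r))) * lookup f (M + Poly_Mapping.single (k, r) 1)"
proof -
  let ?e = "Poly_Mapping.single (k, r) 1 :: nat \<times> nat \<Rightarrow>\<^sub>0 nat"
  have eq: "lookup f N * (of_nat (lookup N (k, r)) * (if N - ?e = M then 1 else 0))
      = (if N = M + ?e then lookup f N * of_nat (lookup N (k, r)) else 0)" for N
  proof -
    have "N - ?e = M \<longleftrightarrow> N = M + ?e" if "lookup N (k, r) \<noteq> 0"
    proof
      assume "N - ?e = M"
      then have M: "M = N - ?e" ..
      show "N = M + ?e" unfolding M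
        by (rule poly_mapping_eqI) (use that in \<open>auto simp: lookup_add lookup_minus lookup_single when_def\<close>)
    next
      assume N: "N = M + ?e"
      show "N - ?e = M" unfolding N 
        by (rule poly_mapping_eqI) (auto simp: lookup_add lookup_minus lookup_single when_def)
    qed
    then show ?thesis by auto
  qed
  have "lookup (pdiff k r f) M
      = (\<Sum>N\<in>keys f. lookup f N * (of_nat (lookup N (k, r)) * (if N - ?e = M then 1 else 0)))"
    unfolding pdiff_def linext_def by (simp add: lookup_sum lookup_single when_def mult.assoc)
  also have "\<dots> = (\<Sum>N\<in>keys f. if N = M + ?e then lookup f N * of_nat (lookup N (k, r)) else 0)"
    by (simp only: eq)
  also have "\<dots> = of_nat (Suc (lookup M (k, r))) * lookup f (M + ?e)"
    by (simp add: in_keys_iff lookup_add algebra_simps)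
  finally show ?thesis .
qed

lemma pdiff_one [simp]: "pdiff k r 1 = 0"
  by (simp add: pdiff_def linext_def)

lemma Sum_any_in_pol_carrier:
  assumes "\<And>i. f i \<in> pol_carrier n"
  shows "Sum_any f \<in> pol_carrier n"
  unfolding Sum_any.expand_set by (rule cvs.subspace_sum[OF subspace_pol_carrier]) (rule assms)

lemma euler_in_pol_carrier:
  assumes "f \<in> pol_carrier n"
  shows "euler n f \<in> pol_carrier n"
  unfolding euler_def
proof (intro cvs.subspace_sum[OF subspace_pol_carrier] Sum_any_in_pol_carrier)
  fix j r :: nat
  assume "j \<in> {1..n}"
  then show "(if odd r then smul (of_nat r) (xvar j r * pdiff j r f) else 0) \<in> pol_carrier n"
    using assms by (auto intro!: cvs.subspace_scale[OF subspace_pol_carrier] xvar_mult_in_pol_carrier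
        pdiff_in_pol_carrier cvs.subspace_0[OF subspace_pol_carrier])
qed

lemma euler_one [simp]: "euler n 1 = 0"
proof -
  have "(if odd r then smul (of_nat r) (xvar j r * pdiff j r 1) else 0) = 0" for j r
    by (simp add: pdiff_one del: One_nat_def)
  then show ?thesis by (simp only: euler_def) simp
qed

lemma heis_in_pol_carrier:
  assumes "f \<in> pol_carrier n" "k \<in> {1..n}" "odd j"
  shows "heis k j f \<in> pol_carrier n"
proof (cases "j > 0")
  case True
  then show ?thesis using assms by (simp add: heis_def pdiff_in_pol_carrier)
next
  case False
  then have "odd (nat (- j))" using assms by (simp add: even_nat_iff)
  then show ?thesis using assms False
    by (auto simp: heis_def simp del: of_nat_nat of_nat_nat_take_bit_eq
        intro!: xvar_mult_in_pol_carrier cvs.subspace_scale[OF subspace_pol_carrier])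
qed

lemma creat_in_pol_carrier:
  assumes "f \<in> pol_carrier n"
  shows "creat n S \<alpha> r f \<in> pol_carrier n"
  using assms unfolding creat_def
  by (auto intro!: cvs.subspace_sum[OF subspace_pol_carrier] cvs.subspace_scale[OF subspace_pol_carrier]
      xvar_mult_in_pol_carrier cvs.subspace_0[OF subspace_pol_carrier])

lemma annih_in_pol_carrier:
  assumes "f \<in> pol_carrier n"
  shows "annih n S \<alpha> r f \<in> pol_carrier n"
  using assms unfolding annih_def
  by (auto intro!: cvs.subspace_neg[OF subspace_pol_carrier] cvs.subspace_sum[OF subspace_pol_carrier]
      cvs.subspace_scale[OF subspace_pol_carrier]
      pdiff_in_pol_carrier cvs.subspace_0[OF subspace_pol_carrier])

lemma ser_exp_in_pol_carrier:
  assumes A: "\<And>r f. f \<in> pol_carrier n \<Longrightarrow> A r f \<in> pol_carrier n" and f: "f \<in> pol_carrier n"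
  shows "ser_exp A p f \<in> pol_carrier n"
proof -
  have "ser_pow A N p f \<in> pol_carrier n" for N p
  proof (induction N arbitrary: p)
    case 0
    then show ?case using f cvs.subspace_0[OF subspace_pol_carrier] by simp
  next
    case (Suc N)
    then show ?case by (auto intro!: cvs.subspace_sum[OF subspace_pol_carrier] A)
  qed
  then show ?thesis unfolding ser_exp_def
    by (intro cvs.subspace_sum[OF subspace_pol_carrier] cvs.subspace_scale[OF subspace_pol_carrier])
qed

lemma vertex_coeff_in_pol_carrier:
  assumes "f \<in> pol_carrier n"
  shows "vertex_coeff n S \<alpha> k f \<in> pol_carrier n"
  unfolding vertex_coeff_def
  by (intro Sum_any_in_pol_carrier)
    (auto intro!: ser_exp_in_pol_carrier creat_in_pol_carrier annih_in_pol_carrier assms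
      cvs.subspace_0[OF subspace_pol_carrier])

lemma ser_exp_zero_index: "ser_exp A 0 f = f"
  by (simp add: ser_exp_def)

text \<open>
  All derivations kill the constant \<open>1\<close>, so only the constant term of the annihilating exponential acts.
\<close>

lemma ser_exp_annih_one: "ser_exp (annih n S \<alpha>) q 1 = (if q = 0 then 1 else 0)"
proof -
  have annih0: "annih n S \<alpha> r 0 = 0" and annih1: "annih n S \<alpha> r 1 = 0" for r
    by (simp_all add: annih_def, simp_all add: pdiff_def)
  have Suc0: "ser_pow (annih n S \<alpha>) (Suc N) p 1 = 0" for N p
  proof (induction N arbitrary: p)
    case 0
    show ?case by (auto simp: annih0 annih1 intro!: sum.neutral)
  next
    case (Suc N)
    have "ser_pow (annih n S \<alpha>) (Suc (Suc N)) p 1 = (\<Sum>r = 1..p. annih n S \<alpha> r 0)"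
      by (subst ser_pow.simps(2)) (simp only: Suc)
    then show ?case by (simp add: annih0)
  qed
  have "ser_pow (annih n S \<alpha>) N q 1 = 0" if "q > 0" for N
    using that Suc0 by (cases N) auto
  then show ?thesis by (simp add: ser_exp_zero_index) (simp add: ser_exp_def)
qed

lemma ser_exp_creat_zero: "ser_exp (creat n S \<alpha>) q 0 = 0"
proof -
  have "ser_pow (creat n S \<alpha>) N p 0 = 0" for N p
    by (induction N arbitrary: p) (auto simp: creat_def intro!: sum.neutral)
  then show ?thesis by (simp add: ser_exp_def)
qed

text \<open>
  What remains on \<open>1\<close> is the creating exponential, a series in nonnegative powers of \<open>z\<close> with
  constant term \<open>1\<close>.
\<close>

lemma vertex_coeff_one:
  assumes "k \<le> 0"
  shows "vertex_coeff n S \<alpha> k 1 = (if k = 0 then 1 else 0)"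
proof -
  have "(\<lambda>q::nat. if 0 \<le> k + int q
       then ser_exp (creat n S \<alpha>) (nat (k + int q)) (ser_exp (annih n S \<alpha>) q 1) else 0)
     = (\<lambda>q. if q = 0 then if k = 0 then 1 else 0 else 0)"
    using assms by (auto simp: fun_eq_iff ser_exp_annih_one ser_exp_creat_zero ser_exp_zero_index)
  then have "vertex_coeff n S \<alpha> k 1
      = Sum_any (\<lambda>q::nat. if q = 0 then if k = 0 then 1 else 0 else (0::pol))"
    by (simp only: vertex_coeff_def)
  also have "\<dots> = (if k = 0 then 1 else 0)"
    by (subst Sum_any.expand_superset[of "{0}"]) auto
  finally show ?thesis .
qed

section \<open>The vectors \<open>v(c\<^sub>1, \<dots>, c\<^sub>n)\<close> under the twisted translations\<close>

text \<open>
  Padding the index sets with zero coefficients lets \<open>\<nu>\<close> be compared for arguments of different support.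
\<close>

lemma nu_eq_prod:
  assumes "finite A" "keys \<alpha> \<subseteq> A" "finite B" "keys \<beta> \<subseteq> B"
  shows "nu \<alpha> \<beta> = (\<Prod>j\<in>A. \<Prod>k\<in>B. nu_simple j k powi (lookup \<alpha> j * lookup \<beta> k))"
proof -
  have "nu \<alpha> \<beta> = (\<Prod>j\<in>keys \<alpha>. \<Prod>k\<in>B. nu_simple j k powi (lookup \<alpha> j * lookup \<beta> k))"
    unfolding nu_def
    by (intro prod.cong refl prod.mono_neutral_left) (use assms in \<open>auto simp: in_keys_iff\<close>)
  also have "\<dots> = (\<Prod>j\<in>A. \<Prod>k\<in>B. nu_simple j k powi (lookup \<alpha> j * lookup \<beta> k))"
    by (intro prod.mono_neutral_left) (use assms in \<open>auto simp: in_keys_iff\<close>)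
  finally show ?thesis .
qed

lemma nu_add_right: "nu \<alpha> (\<beta> + \<gamma>) = nu \<alpha> \<beta> * nu \<alpha> \<gamma>"
proof -
  let ?B = "keys \<beta> \<union> keys \<gamma>"
  have nz: "nu_simple j k \<noteq> 0" for j k by (simp add: nu_simple_def)
  show ?thesis
    using keys_add[of \<beta> \<gamma>]
    by (simp add: nu_eq_prod[of "keys \<alpha>" _ ?B] lookup_add distrib_left power_int_add nz prod.distrib)
qed

lemma nu_0_right [simp]: "nu \<alpha> 0 = 1"
  by (simp add: nu_def)

lemma nu_sum_right: "nu \<alpha> (\<Sum>i\<in>I. \<beta> i) = (\<Prod>i\<in>I. nu \<alpha> (\<beta> i))"
  by (induction I rule: infinite_finite_induct) (simp_all add: nu_add_right)

text \<open>
  The factor that the sign at \<open>l\<close> acquires under the twisted translation by \<open>\<alpha>\<close>. It is the product of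
  \<open>\<nu>(\<alpha>,\<alpha>\<^sub>l)\<close> and \<open>-1\<close> to the power of the coefficient of \<open>\<alpha>\<close> at \<open>l\<close>; the truncated
  difference \<open>l - 1\<close> is harmless as it matters for odd \<open>l\<close> only.
\<close>

definition flip :: "lat \<Rightarrow> nat \<Rightarrow> complex" where
  "flip \<alpha> l = (if odd l \<and> odd (lookup \<alpha> (l - 1) + lookup \<alpha> (l + 1)) then -1 else 1)"

text \<open>
  In \<open>\<nu>(\<alpha>,\<alpha>\<^sub>l)\<close> the index \<open>l\<close> contributes a sign, and a neighbour \<open>k\<close> of \<open>l\<close> contributes one if \<open>k\<close> is
  even. So both neighbours contribute for odd \<open>l\<close> and none does for even \<open>l\<close>.
\<close>

lemma nu_simple_root_right:
  "nu \<alpha> (simple_root l) = (if odd (lookup \<alpha> l) then - flip \<alpha> l else flip \<alpha> l)"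
proof -
  have key: "nu \<alpha> (simple_root l) = (\<Prod>k\<in>K. nu_simple k l powi lookup \<alpha> k)"
    if fin: "finite K" and K: "\<And>k. k \<in> keys \<alpha> \<Longrightarrow> nu_simple k l \<noteq> 1 \<Longrightarrow> k \<in> K" for K
  proof -
    have "nu \<alpha> (simple_root l) = (\<Prod>k\<in>keys \<alpha> \<union> K. nu_simple k l powi lookup \<alpha> k)"
      using fin by (subst nu_eq_prod[of "keys \<alpha> \<union> K" _ "{l}"]) (auto simp: simple_root_def)
    also have "\<dots> = (\<Prod>k\<in>K. nu_simple k l powi lookup \<alpha> k)"
    proof (rule prod.mono_neutral_right)
      show "\<forall>k\<in>keys \<alpha> \<union> K - K. nu_simple k l powi lookup \<alpha> k = 1"
      proof
        fix k assume "k \<in> keys \<alpha> \<union> K - K"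
        then have "nu_simple k l = 1" using K by blast
        then show "nu_simple k l powi lookup \<alpha> k = 1" by simp
      qed
    qed (use fin in auto)
    finally show ?thesis .
  qed
  show ?thesis
  proof (cases "odd l")
    case True
    then obtain p where l: "l = Suc (2 * p)" by (auto elim: oddE)
    have "nu \<alpha> (simple_root l) = (\<Prod>k\<in>{2 * p, Suc (2 * p), Suc (Suc (2 * p))}. nu_simple k l powi lookup \<alpha> k)"
      by (rule key) (auto simp: l nu_simple_def split: if_splits)
    also have "\<dots> = (-1) powi lookup \<alpha> (2 * p) * ((-1) powi lookup \<alpha> (Suc (2 * p)) * (-1) powi lookup \<alpha> (Suc (Suc (2 * p))))"
      by (simp add: l nu_simple_def)
    also have "\<dots> = (if odd (lookup \<alpha> l) then - flip \<alpha> l else flip \<alpha> l)"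
      by (simp add: l flip_def power_int_minus_left)
    finally show ?thesis .
  next
    case False
    have "nu \<alpha> (simple_root l) = (\<Prod>k\<in>{l}. nu_simple k l powi lookup \<alpha> k)"
      by (rule key) (use False in \<open>auto simp: nu_simple_def split: if_splits\<close>)
    also have "\<dots> = (if odd (lookup \<alpha> l) then - flip \<alpha> l else flip \<alpha> l)"
      using False by (simp add: nu_simple_def flip_def power_int_minus_left)
    finally show ?thesis .
  qed
qed

lemma gexp_0: "gexp 0 = 1"
  by (simp add: gexp_def)

lemma gexp_add: "gexp (\<gamma> + \<delta>) = gexp \<gamma> * gexp \<delta>"
  by (simp add: gexp_def mult_single)

lemma red_0 [simp]: "red 0 = 0"
  by (rule poly_mapping_eqI) simp

lemma gexp_red_sum: "gexp (red (\<Sum>i\<in>I. \<alpha> i)) = (\<Prod>i\<in>I. gexp (red (\<alpha> i)))"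
  by (induction I rule: infinite_finite_induct) (simp_all add: gexp_0 red_add gexp_add)

text \<open>
  Each class of \<open>Q/2Q\<close> is represented here by a sum of distinct simple roots, which provides the
  lattice vector \<open>\<gamma>\<close> in terms of which the operators are prescribed.
\<close>

lemma vac_expansion:
  "vac n b = (\<Sum>A\<in>Pow {1..n}. smul (\<Prod>j\<in>A. \<i> * b j) (gexp (red (\<Sum>j\<in>A. simple_root j))))"
proof -
  have "vac n b = (\<Prod>j\<in>{1..n}. smul (\<i> * b j) (gexp (red (simple_root j))) + 1)"
    unfolding vac_def by (simp add: add.commute)
  also have "\<dots> = (\<Sum>A\<in>Pow {1..n}. (\<Prod>j\<in>A. smul (\<i> * b j) (gexp (red (simple_root j)))) * (\<Prod>j\<in>{1..n} - A. 1))"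
    by (rule prod_add) simp
  also have "\<dots> = (\<Sum>A\<in>Pow {1..n}. smul (\<Prod>j\<in>A. \<i> * b j) (gexp (red (\<Sum>j\<in>A. simple_root j))))"
  proof (intro sum.cong refl)
    fix A assume "A \<in> Pow {1..n}"
    then have "finite A" using finite_subset by auto
    then show "(\<Prod>j\<in>A. smul (\<i> * b j) (gexp (red (simple_root j)))) * (\<Prod>j\<in>{1..n} - A. 1)
        = smul (\<Prod>j\<in>A. \<i> * b j) (gexp (red (\<Sum>j\<in>A. simple_root j)))"
      by (simp only: prod_smul gexp_red_sum prod.neutral_const mult_1_right)
  qed
  finally show ?thesis .
qed

lemma vac_cong: "(\<And>l. l \<in> {1..n} \<Longrightarrow> b l = b' l) \<Longrightarrow> vac n b = vac n b'"
  unfolding vac_def by (rule prod.cong) auto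

lemma lookup_sum_simple_root:
  assumes "finite A"
  shows "lookup (\<Sum>j\<in>A. simple_root j) l = (if l \<in> A then 1 else 0)"
  using assms by (simp add: lookup_sum simple_root_def lookup_single when_def)

text \<open>
  The coefficient at the neutral element is \<open>1\<close>, since a sum of distinct simple roots is
  congruent to \<open>0\<close> modulo \<open>2Q\<close> only if it is empty.
\<close>

lemma vac_nonzero: "vac n b \<noteq> 0"
proof -
  have red: "red (\<Sum>j\<in>A. simple_root j) = 0 \<longleftrightarrow> A = {}" if "A \<in> Pow {1..n}" for A
  proof
    assume *: "red (\<Sum>j\<in>A. simple_root j) = 0"
    have "finite A" using that finite_subset by auto
    then have of_int_0: "(of_int (if l \<in> A then 1 else 0) :: bit) = 0" for l
      using arg_cong[OF *, of "\<lambda>x. lookup x l"] by (simp only: lookup_red lookup_sum_simple_root lookup_zero)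
    have "l \<notin> A" for l
      using of_int_0[of l] by auto
    then show "A = {}" by blast
  qed simp
  have "lookup (vac n b) 0 = (\<Sum>A\<in>Pow {1..n}. if A = {} then 1 else 0)"
    unfolding vac_expansion lookup_sum
    by (rule sum.cong) (auto simp: gexp_def lookup_single when_def red[simplified])
  then have "lookup (vac n b) 0 = 1" by simp
  then show ?thesis by auto
qed

text \<open>
  On the left-hand side \<open>\<nu>\<close> has already been multiplied into the signs. It remains to multiply the factor at each \<open>l\<close>
  by the generator \<open>e\<close> belonging to \<open>\<alpha>\<^sub>l\<close> if \<open>\<alpha>\<close> has an odd coefficient there: as \<open>e\<^sup>2 = 1\<close> and \<open>a\<^sup>2 = 1\<close> for a sign
  \<open>a\<close>, one has \<open>e (1 - i a e) = - i a (1 + i a e)\<close>.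
\<close>

lemma twisted_translation_vac:
  assumes \<alpha>: "\<alpha> \<in> root_lattice n" and b: "sign_family n b"
  shows "gexp (red \<alpha>) * vac n (\<lambda>l. nu \<alpha> (simple_root l) * b l)
    = smul (\<Prod>l | l \<in> {1..n} \<and> odd (lookup \<alpha> l). - \<i> * (flip \<alpha> l * b l)) (vac n (\<lambda>l. flip \<alpha> l * b l))"
proof -
  let ?E = "\<lambda>l. gexp (red (simple_root l))"
  let ?s = "\<lambda>l. if odd (lookup \<alpha> l) then - \<i> * (flip \<alpha> l * b l) else 1"
  have EE: "?E l * ?E l = 1" for l
    using red_eq_iff[of "simple_root l + simple_root l" 0]
    by (metis add.left_neutral gexp_0 gexp_add red_0 red_add)
  have "red \<alpha> = red (\<Sum>l\<in>{1..n}. if odd (lookup \<alpha> l) then simple_root l else 0)"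
  proof (rule poly_mapping_eqI)
    fix k
    have "lookup (\<Sum>l\<in>{1..n}. if odd (lookup \<alpha> l) then simple_root l else 0) k
        = (\<Sum>l\<in>{1..n}. if l = k then if odd (lookup \<alpha> k) then 1 else 0 else 0)"
      unfolding lookup_sum by (rule sum.cong) (auto simp: simple_root_def lookup_single when_def)
    also have "\<dots> = (if odd (lookup \<alpha> k) then 1 else 0)"
    proof (cases "k \<in> {1..n}")
      case False
      then have "lookup \<alpha> k = 0" using \<alpha> by (auto simp: root_lattice_def in_keys_iff)
      then show ?thesis using False by simp
    qed simp
    finally show "lookup (red \<alpha>) k = lookup (red (\<Sum>l\<in>{1..n}. if odd (lookup \<alpha> l) then simple_root l else 0)) k"
      by (simp add: of_int_bit)
  qed
  then have "gexp (red \<alpha>) = (\<Prod>l\<in>{1..n}. if odd (lookup \<alpha> l) then ?E l else 1)"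
    by (simp only: gexp_red_sum) (simp add: if_distrib gexp_0 cong: if_cong)
  then have "gexp (red \<alpha>) * vac n (\<lambda>l. nu \<alpha> (simple_root l) * b l)
     = (\<Prod>l\<in>{1..n}. (if odd (lookup \<alpha> l) then ?E l else 1) * (1 + smul (\<i> * (nu \<alpha> (simple_root l) * b l)) (?E l)))"
    by (simp add: vac_def prod.distrib)
  also have "\<dots> = (\<Prod>l\<in>{1..n}. smul (?s l) (1 + smul (\<i> * (flip \<alpha> l * b l)) (?E l)))"
  proof (rule prod.cong[OF refl])
    fix l assume "l \<in> {1..n}"
    then have "b l = 1 \<or> b l = -1" using b by (auto simp: sign_family_def)
    then have sq: "(flip \<alpha> l * b l) * (flip \<alpha> l * b l) = 1" by (auto simp: flip_def)
    show "(if odd (lookup \<alpha> l) then ?E l else 1) * (1 + smul (\<i> * (nu \<alpha> (simple_root l) * b l)) (?E l))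
        = smul (?s l) (1 + smul (\<i> * (flip \<alpha> l * b l)) (?E l))"
    proof (cases "odd (lookup \<alpha> l)")
      case True
      have "?E l * (1 + smul (\<i> * (- flip \<alpha> l * b l)) (?E l)) = ?E l + smul (- \<i> * (flip \<alpha> l * b l)) 1"
        by (simp add: distrib_left right_diff_distrib smul_mult_right EE)
      also have "\<dots> = smul (- \<i> * (flip \<alpha> l * b l)) 1
          + smul ((- \<i> * (flip \<alpha> l * b l)) * (\<i> * (flip \<alpha> l * b l))) (?E l)"
      proof -
        have "(- \<i> * x) * (\<i> * x) = x * x" for x :: complex
          by (simp add: algebra_simps)
        then show ?thesis by (simp only: sq) (simp add: add.commute)
      qed
      also have "\<dots> = smul (- \<i> * (flip \<alpha> l * b l)) (1 + smul (\<i> * (flip \<alpha> l * b l)) (?E l))"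
        by (simp only: cvs.scale_right_distrib cvs.scale_scale)
      finally show ?thesis using True by (simp add: nu_simple_root_right)
    qed (simp add: nu_simple_root_right)
  qed
  also have "\<dots> = smul (\<Prod>l\<in>{1..n}. ?s l) (vac n (\<lambda>l. flip \<alpha> l * b l))"
    by (simp add: prod_smul vac_def)
  also have "(\<Prod>l\<in>{1..n}. ?s l) = (\<Prod>l | l \<in> {1..n} \<and> odd (lookup \<alpha> l). - \<i> * (flip \<alpha> l * b l))"
    by (rule prod.inter_filter[symmetric]) simp
  finally show ?thesis .
qed

lemma subspace_grpalg_carrier: "cvs.subspace (grpalg_carrier n)"
proof (rule cvs.subspaceI)
  show "0 \<in> grpalg_carrier n" by (simp add: grpalg_carrier_def)
next
  fix x y assume "x \<in> grpalg_carrier n" "y \<in> grpalg_carrier n"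
  then show "x + y \<in> grpalg_carrier n"
    using keys_add[of x y] unfolding grpalg_carrier_def by blast
next
  fix c and x :: grpalg
  assume x: "x \<in> grpalg_carrier n"
  have "keys (smul c x) \<subseteq> keys x" by (auto simp: in_keys_iff)
  with x show "smul c x \<in> grpalg_carrier n"
    unfolding grpalg_carrier_def by blast
qed

lemma gexp_in_grpalg_carrier:
  assumes "\<gamma> \<in> root_lattice n"
  shows "gexp (red \<gamma>) \<in> grpalg_carrier n"
proof -
  have "keys (red \<gamma>) \<subseteq> keys \<gamma>" by (auto simp: in_keys_iff)
  then show ?thesis using assms by (auto simp: grpalg_carrier_def gexp_def root_lattice_def)
qed

lemma sum_simple_root_in_root_lattice:
  assumes "A \<in> Pow {1..n}"
  shows "(\<Sum>j\<in>A. simple_root j) \<in> root_lattice n"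
proof -
  have "finite A" using assms finite_subset by auto
  then show ?thesis using assms
    by (auto simp: root_lattice_def in_keys_iff lookup_sum_simple_root split: if_splits)
qed

lemma vac_in_grpalg_carrier: "vac n b \<in> grpalg_carrier n"
  unfolding vac_expansion
  by (intro cvs.subspace_sum[OF subspace_grpalg_carrier] cvs.subspace_scale[OF subspace_grpalg_carrier]
      gexp_in_grpalg_carrier sum_simple_root_in_root_lattice)

lemma lookup_chain_root: "lookup (chain_root j k) l = (if j \<le> l \<and> l \<le> k then 1 else 0)"
  unfolding chain_root_def by (simp add: lookup_sum_simple_root)

lemma chain_root_in_roots: "1 \<le> j \<Longrightarrow> j \<le> k \<Longrightarrow> k \<le> n \<Longrightarrow> chain_root j k \<in> roots n"
  unfolding roots_def by blast

lemma roots_uminus: "\<alpha> \<in> roots n \<Longrightarrow> - \<alpha> \<in> roots n"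
  unfolding roots_def by auto

lemma roots_subset_root_lattice: "roots n \<subseteq> root_lattice n"
  by (auto simp: roots_def root_lattice_def in_keys_iff lookup_chain_root split: if_splits)

section \<open>The action on vectors \<open>v(c) \<otimes> f\<close>\<close>

locale twisted_vertex_module =
  fixes n :: nat and S :: "nat \<Rightarrow> galg" and \<rho> :: "ghat \<Rightarrow> fock \<Rightarrow> fock"
  assumes orthonormal: "orthonormal_basis n S" and action: "affine_action n S \<rho>"
begin

lemma lie_module_fock: "lie_module (ghat_carrier n) (ghat_bracket n) \<rho> (fock_carrier n)"
  using action by (simp add: affine_action_def)

lemma subspace_fock: "cvs.subspace (fock_carrier n)"
  unfolding fock_carrier_def by (rule subspace_tensor_space)

lemma subspace_ghat: "cvs.subspace (ghat_carrier n)"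
  unfolding ghat_carrier_def by (rule cvs.subspace_span)

lemma \<rho>_add_right:
  "x \<in> ghat_carrier n \<Longrightarrow> v \<in> fock_carrier n \<Longrightarrow> w \<in> fock_carrier n \<Longrightarrow> \<rho> x (v + w) = \<rho> x v + \<rho> x w"
  using lie_module_fock by (simp add: lie_module_def)

lemma \<rho>_smul_right:
  "x \<in> ghat_carrier n \<Longrightarrow> v \<in> fock_carrier n \<Longrightarrow> \<rho> x (smul c v) = smul c (\<rho> x v)"
  using lie_module_fock by (simp add: lie_module_def)

lemma \<rho>_add_left:
  "x \<in> ghat_carrier n \<Longrightarrow> y \<in> ghat_carrier n \<Longrightarrow> v \<in> fock_carrier n \<Longrightarrow> \<rho> (x + y) v = \<rho> x v + \<rho> y v"
  using lie_module_fock by (simp add: lie_module_def)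

lemma \<rho>_smul_left:
  "x \<in> ghat_carrier n \<Longrightarrow> v \<in> fock_carrier n \<Longrightarrow> \<rho> (smul c x) v = smul c (\<rho> x v)"
  using lie_module_fock by (simp add: lie_module_def)

lemma \<rho>_0_left: "v \<in> fock_carrier n \<Longrightarrow> \<rho> 0 v = 0"
  using \<rho>_smul_left[of 0 v 0] cvs.subspace_0[OF subspace_ghat] by simp

lemma \<rho>_0_right: "x \<in> ghat_carrier n \<Longrightarrow> \<rho> x 0 = 0"
  using \<rho>_smul_right[of x 0 0] cvs.subspace_0[OF subspace_fock] by simp

lemma \<rho>_diff_left:
  assumes "x \<in> ghat_carrier n" "y \<in> ghat_carrier n" "v \<in> fock_carrier n"
  shows "\<rho> (x - y) v = \<rho> x v - \<rho> y v"
  using \<rho>_add_left[of "x - y" y v] assms cvs.subspace_diff[OF subspace_ghat] by simp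

lemma \<rho>_sum_right:
  assumes "x \<in> ghat_carrier n" "\<And>i. i \<in> I \<Longrightarrow> v i \<in> fock_carrier n"
  shows "\<rho> x (\<Sum>i\<in>I. v i) = (\<Sum>i\<in>I. \<rho> x (v i))"
  using assms(2)
  by (induction I rule: infinite_finite_induct)
    (simp_all add: \<rho>_0_right \<rho>_add_right assms(1) cvs.subspace_sum[OF subspace_fock])

lemma tens_in_fock: "u \<in> grpalg_carrier n \<Longrightarrow> f \<in> pol_carrier n \<Longrightarrow> tens u f \<in> fock_carrier n"
  unfolding fock_carrier_def by (rule tens_in_tensor_space)

lemma tens_vac_in_fock: "f \<in> pol_carrier n \<Longrightarrow> tens (vac n b) f \<in> fock_carrier n"
  by (simp add: tens_in_fock vac_in_grpalg_carrier)

text \<open>Linear extension from the group elements \<open>e\<^sup>\<gamma>\<close>, on which the operators are prescribed.\<close>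

lemma \<rho>_tens_vac:
  assumes x: "x \<in> ghat_carrier n" and f: "f \<in> pol_carrier n"
    and gen: "\<And>\<gamma>. \<gamma> \<in> root_lattice n \<Longrightarrow> \<rho> x (tens (gexp (red \<gamma>)) f) = tens (T \<gamma>) g"
  shows "\<rho> x (tens (vac n b) f)
    = tens (\<Sum>A\<in>Pow {1..n}. smul (\<Prod>j\<in>A. \<i> * b j) (T (\<Sum>j\<in>A. simple_root j))) g"
proof -
  have F: "tens (gexp (red (\<Sum>j\<in>A. simple_root j))) f \<in> fock_carrier n" if "A \<in> Pow {1..n}" for A
    by (intro tens_in_fock f gexp_in_grpalg_carrier sum_simple_root_in_root_lattice that)
  have "\<rho> x (tens (vac n b) f)
     = \<rho> x (\<Sum>A\<in>Pow {1..n}. smul (\<Prod>j\<in>A. \<i> * b j) (tens (gexp (red (\<Sum>j\<in>A. simple_root j))) f))"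
    by (subst vac_expansion) (simp add: tens_sum_left tens_bilinear)
  also have "\<dots> = (\<Sum>A\<in>Pow {1..n}. smul (\<Prod>j\<in>A. \<i> * b j) (tens (T (\<Sum>j\<in>A. simple_root j)) g))"
    by (subst \<rho>_sum_right)
      (auto simp: x F \<rho>_smul_right gen sum_simple_root_in_root_lattice
        intro!: cvs.subspace_scale[OF subspace_fock] sum.cong)
  finally show ?thesis by (simp add: tens_sum_left tens_bilinear)
qed

lemma loop_root_in_ghat:
  assumes "\<alpha> \<in> roots n"
  shows "loop (Xvec \<alpha> + smul ((-1) powi j) (Xvec (- \<alpha>))) j \<in> ghat_carrier n"
proof -
  have "keys (Xvec \<alpha> + smul ((-1) powi j) (Xvec (- \<alpha>))) \<subseteq> {Xb \<alpha>, Xb (- \<alpha>)}"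
    by (auto simp: in_keys_iff lookup_add Xvec_def lookup_single when_def split: if_splits)
  then have "Xvec \<alpha> + smul ((-1) powi j) (Xvec (- \<alpha>)) \<in> galg_carrier n"
    using assms roots_uminus[OF assms] unfolding galg_carrier_def by blast
  moreover have "sigma (Xvec \<alpha> + smul ((-1) powi j) (Xvec (- \<alpha>)))
      = smul ((-1) powi j) (Xvec \<alpha> + smul ((-1) powi j) (Xvec (- \<alpha>)))"
  proof -
    have "sigma (Xvec \<alpha> + smul ((-1) powi j) (Xvec (- \<alpha>))) = Xvec (- \<alpha>) + smul ((-1) powi j) (Xvec \<alpha>)"
      by (simp add: sigma_def linext_add linext_smul Xvec_def)
    then show ?thesis
      by (cases "even j") (simp_all add: power_int_minus_left cvs.scale_right_distrib)
  qed
  ultimately have "Xvec \<alpha> + smul ((-1) powi j) (Xvec (- \<alpha>)) \<in> g_graded n j"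
    by (simp add: g_graded_def)
  then show ?thesis unfolding ghat_carrier_def by (intro cvs.span_base) blast
qed

lemma loop_cartan_in_ghat:
  assumes "H \<in> cartan n" "odd j"
  shows "loop H j \<in> ghat_carrier n"
proof -
  have "H \<in> galg_carrier n"
    using assms by (auto simp: cartan_def galg_carrier_def)
  moreover have "sigma H = smul ((-1) powi j) H"
  proof -
    have "sigma H = (\<Sum>a\<in>keys H. smul (lookup H a) (- Poly_Mapping.single a 1))"
      unfolding sigma_def linext_def using assms(1)
      by (intro sum.cong) (auto simp: cartan_def)
    also have "\<dots> = - H"
      using sum_smul_single[of "keys H" H] by (simp add: sum_negf)
    finally show ?thesis using assms(2) by (simp add: power_int_minus_left)
  qed
  ultimately show ?thesis unfolding ghat_carrier_def g_graded_def by (intro cvs.span_base) blast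
qed

lemma Kvec_in_ghat: "Kvec \<in> ghat_carrier n"
  unfolding ghat_carrier_def by (intro cvs.span_base) blast

lemma Dvec_in_ghat: "Dvec \<in> ghat_carrier n"
  unfolding ghat_carrier_def by (intro cvs.span_base) blast

text \<open>
  The cocycle factors \<open>\<nu>(\<alpha>,\<gamma>)\<close> of the terms of \<open>v(b)\<close> are multiplicative in \<open>\<gamma>\<close>, so they can be
  absorbed into the signs before \<open>v(b)\<close> is translated by \<open>\<alpha>\<close>.
\<close>

lemma \<rho>_root_vac:
  assumes \<alpha>: "\<alpha> \<in> roots n" and b: "sign_family n b" and f: "f \<in> pol_carrier n"
  shows "\<rho> (loop (Xvec \<alpha> + smul ((-1) powi j) (Xvec (- \<alpha>))) j) (tens (vac n b) f)
    = smul (1/2 * (\<Prod>l | l \<in> {1..n} \<and> odd (lookup \<alpha> l). - \<i> * (flip \<alpha> l * b l)))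
        (tens (vac n (\<lambda>l. flip \<alpha> l * b l)) (vertex_coeff n S \<alpha> (- j) f))"
proof -
  let ?x = "loop (Xvec \<alpha> + smul ((-1) powi j) (Xvec (- \<alpha>))) j"
  let ?g = "vertex_coeff n S \<alpha> (- j) f"
  have "\<rho> ?x (tens (vac n b) f)
      = tens (\<Sum>A\<in>Pow {1..n}. smul (\<Prod>j\<in>A. \<i> * b j)
          (smul (1/2 * nu \<alpha> (\<Sum>j\<in>A. simple_root j)) (gexp (red (\<alpha> + (\<Sum>j\<in>A. simple_root j)))))) ?g"
    by (rule \<rho>_tens_vac)
      (use action \<alpha> f loop_root_in_ghat in \<open>auto simp: affine_action_def tens_bilinear\<close>)
  also have "(\<Sum>A\<in>Pow {1..n}. smul (\<Prod>j\<in>A. \<i> * b j)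
          (smul (1/2 * nu \<alpha> (\<Sum>j\<in>A. simple_root j)) (gexp (red (\<alpha> + (\<Sum>j\<in>A. simple_root j))))))
      = smul (1/2) (gexp (red \<alpha>) * vac n (\<lambda>l. nu \<alpha> (simple_root l) * b l))"
    unfolding vac_expansion sum_distrib_left cvs.scale_sum_right
    by (intro sum.cong refl)
      (simp add: nu_sum_right red_add gexp_add smul_mult_right prod.distrib mult_ac)
  also have "\<dots> = smul (1/2 * (\<Prod>l | l \<in> {1..n} \<and> odd (lookup \<alpha> l). - \<i> * (flip \<alpha> l * b l)))
      (vac n (\<lambda>l. flip \<alpha> l * b l))"
    by (subst twisted_translation_vac[OF subsetD[OF roots_subset_root_lattice \<alpha>] b]) (simp only: cvs.scale_scale)
  finally show ?thesis by (simp add: tens_bilinear)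
qed

lemma \<rho>_cartan_vac:
  assumes H: "H \<in> cartan n" and j: "odd j" and f: "f \<in> pol_carrier n"
  shows "\<rho> (loop H j) (tens (vac n b) f)
    = tens (vac n b) (smul (1 / of_real (sqrt 2)) (\<Sum>k = 1..n. smul (g_form H (S k)) (heis k j f)))"
  using \<rho>_tens_vac[OF loop_cartan_in_ghat[OF H j] f, of "\<lambda>\<gamma>. gexp (red \<gamma>)", folded vac_expansion]
    action H j f by (simp add: affine_action_def)

lemma \<rho>_Kvec_vac:
  assumes f: "f \<in> pol_carrier n"
  shows "\<rho> Kvec (tens (vac n b) f) = tens (vac n b) f"
  using \<rho>_tens_vac[OF Kvec_in_ghat f, of "\<lambda>\<gamma>. gexp (red \<gamma>)", folded vac_expansion]
    action f by (simp add: affine_action_def)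

lemma \<rho>_Dvec_vac:
  assumes f: "f \<in> pol_carrier n"
  shows "\<rho> Dvec (tens (vac n b) f) = tens (vac n b) (- euler n f)"
  using \<rho>_tens_vac[OF Dvec_in_ghat f, of "\<lambda>\<gamma>. gexp (red \<gamma>)", folded vac_expansion]
    action f by (simp add: affine_action_def)

lemma S_in_cartan: "k \<in> {1..n} \<Longrightarrow> S k \<in> cartan n"
  using orthonormal by (simp add: orthonormal_basis_def)

text \<open>
  By orthonormality \<open>S\<^sub>k\<close> picks out the variables with first index \<open>k\<close>.
\<close>

lemma \<rho>_S_vac:
  assumes k: "k \<in> {1..n}" and j: "odd j" and f: "f \<in> pol_carrier n"
  shows "\<rho> (loop (S k) j) (tens (vac n b) f) = smul (1 / of_real (sqrt 2)) (tens (vac n b) (heis k j f))"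
proof -
  have "(\<Sum>k' = 1..n. smul (g_form (S k) (S k')) (heis k' j f)) = (\<Sum>k' = 1..n. if k' = k then heis k j f else 0)"
    by (rule sum.cong) (use orthonormal k in \<open>auto simp: orthonormal_basis_def\<close>)
  then show ?thesis using k
    by (simp add: \<rho>_cartan_vac[OF S_in_cartan[OF k] j f] tens_bilinear)
qed

lemma Y_in_ghat: "\<alpha> \<in> roots n \<Longrightarrow> Y \<alpha> \<in> ghat_carrier n"
  using loop_root_in_ghat[of \<alpha> 0] by (simp add: Y_def)

text \<open>
  The zero modes \<open>Y\<close> act on \<open>v(b) \<otimes> 1\<close> through the group algebra only, because the vertex
  operator fixes the constant polynomial in degree zero.
\<close>

lemma \<rho>_Y_vac:
  assumes "\<alpha> \<in> roots n" "sign_family n b"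
  shows "\<rho> (Y \<alpha>) (tens (vac n b) 1)
    = smul (1/2 * (\<Prod>l | l \<in> {1..n} \<and> odd (lookup \<alpha> l). - \<i> * (flip \<alpha> l * b l)))
        (tens (vac n (\<lambda>l. flip \<alpha> l * b l)) 1)"
  using \<rho>_root_vac[OF assms one_in_pol_carrier, of 0] by (simp add: Y_def vertex_coeff_one)

lemma Yc_in_ghat: "1 \<le> j \<Longrightarrow> j \<le> k \<Longrightarrow> k \<le> n \<Longrightarrow> Yc j k \<in> ghat_carrier n"
  unfolding Yc_def by (intro Y_in_ghat chain_root_in_roots)

lemma \<rho>_Yc_vac:
  assumes "1 \<le> j" "j \<le> k" "k \<le> n" and b: "sign_family n b"
    and b': "\<And>l. l \<in> {1..n} \<Longrightarrow> b' l = flip (chain_root j k) l * b l"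
  shows "\<rho> (Yc j k) (tens (vac n b) 1) = smul (1/2 * (\<Prod>l = j..k. - \<i> * b' l)) (tens (vac n b') 1)"
proof -
  have "vac n (\<lambda>l. flip (chain_root j k) l * b l) = vac n b'"
    by (rule vac_cong) (simp add: b')
  moreover have "{l. l \<in> {1..n} \<and> odd (lookup (chain_root j k) l)} = {j..k}"
    using assms by (auto simp: lookup_chain_root)
  moreover have "(\<Prod>l = j..k. - \<i> * (flip (chain_root j k) l * b l)) = (\<Prod>l = j..k. - \<i> * b' l)"
    using assms(1-3) by (intro prod.cong) (auto simp: b')
  ultimately show ?thesis
    using \<rho>_Y_vac[OF chain_root_in_roots[OF assms(1-3)] b] by (simp add: Yc_def del: prod_constant)
qed

lemma flip_chain_odd:
  assumes "odd j"
  shows "flip (chain_root j j) l = 1"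
proof -
  have "even l \<or> (l - 1 \<noteq> j \<and> l + 1 \<noteq> j)"
    using assms by presburger
  then show ?thesis by (auto simp: flip_def lookup_chain_root)
qed

text \<open>
  The support of \<open>\<alpha>\<^sub>j\<close> with odd \<open>j\<close> contains no even index, so no sign is flipped. The eigenvalues
  of these operators recover the odd signs.
\<close>

lemma \<rho>_Yc_odd:
  assumes "j \<in> {1..n}" "odd j" "sign_family n b"
  shows "\<rho> (Yc j j) (tens (vac n b) 1) = smul (- \<i> / 2 * b j) (tens (vac n b) 1)"
  using \<rho>_Yc_vac[of j j b b] assms by (simp add: flip_chain_odd)

end

section \<open>Chevalley generators\<close>

context twisted_vertex_module
begin

lemma tens_vac_one_nonzero: "tens (vac n b) 1 \<noteq> 0"
proof
  assume *: "tens (vac n b) 1 = 0"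
  have "vac n b = 0"
  proof (rule poly_mapping_eqI)
    show "lookup (vac n b) \<gamma> = lookup 0 \<gamma>" for \<gamma>
      using arg_cong[OF *, of "\<lambda>x. lookup x (\<gamma>, 0)"] by simp
  qed
  then show False using vac_nonzero by blast
qed

text \<open>
  The only even index in each of these four chains is \<open>2j\<close>, so all of them flip the signs at
  \<open>2j - 1\<close> and \<open>2j + 1\<close> and map \<open>v(c)\<close> to multiples of one vector.
\<close>

lemma \<rho>_Yc_around_even:
  assumes j: "1 \<le> j" "2 * j + 1 \<le> n" and c: "sign_family n c"
  defines "c' \<equiv> c(2*j-1 := - c (2*j-1), 2*j+1 := - c (2*j+1))"
  shows "\<rho> (Yc (2*j-1) (2*j)) (tens (vac n c) 1) = smul (c (2*j-1) * c (2*j) / 2) (tens (vac n c') 1)"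
    and "\<rho> (Yc (2*j) (2*j+1)) (tens (vac n c) 1) = smul (c (2*j) * c (2*j+1) / 2) (tens (vac n c') 1)"
    and "\<rho> (Yc (2*j-1) (2*j+1)) (tens (vac n c) 1)
      = smul (\<i> * c (2*j-1) * c (2*j) * c (2*j+1) / 2) (tens (vac n c') 1)"
    and "\<rho> (Yc (2*j) (2*j)) (tens (vac n c) 1) = smul (- \<i> * c (2*j) / 2) (tens (vac n c') 1)"
proof -
  obtain p where p: "j = Suc p" using j by (cases j) auto
  have flip: "c' l = flip (chain_root x y) l * c l"
    if "x = 2*j-1 \<or> x = 2*j" "y = 2*j \<or> y = 2*j+1" for x y l
  proof -
    have "odd l \<and> odd (lookup (chain_root x y) (l - 1) + lookup (chain_root x y) (l + 1))
        \<longleftrightarrow> l = 2*j-1 \<or> l = 2*j+1"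
    proof (cases "odd l")
      case True
      then obtain q where q: "l = Suc (2 * q)" by (auto elim: oddE)
      show ?thesis using that by (auto simp: lookup_chain_root q p) presburger+
    next
      case False
      then show ?thesis by (auto simp: p)
    qed
    then show ?thesis by (auto simp: flip_def c'_def)
  qed
  have sets: "{2*j-1..2*j} = {2*j-1, 2*j}" "{2*j..2*j+1} = {2*j, 2*j+1}"
    "{2*j-1..2*j+1} = {2*j-1, 2*j, 2*j+1}"
    using j by auto
  have c': "c' (2*j-1) = - c (2*j-1)" "c' (2*j) = c (2*j)" "c' (2*j+1) = - c (2*j+1)"
    using j by (auto simp: c'_def)
  have dist: "2*j-1 \<noteq> 2*j" "2*j-1 \<noteq> 2*j+1" using j by auto
  have "\<rho> (Yc (2*j-1) (2*j)) (tens (vac n c) 1)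
      = smul (1/2 * (\<Prod>l = 2*j-1..2*j. - \<i> * c' l)) (tens (vac n c') 1)"
    by (rule \<rho>_Yc_vac) (use j c flip in auto)
  then show "\<rho> (Yc (2*j-1) (2*j)) (tens (vac n c) 1) = smul (c (2*j-1) * c (2*j) / 2) (tens (vac n c') 1)"
    using dist c' unfolding sets by (simp add: algebra_simps)
  have "\<rho> (Yc (2*j) (2*j+1)) (tens (vac n c) 1)
      = smul (1/2 * (\<Prod>l = 2*j..2*j+1. - \<i> * c' l)) (tens (vac n c') 1)"
    by (rule \<rho>_Yc_vac) (use j c flip in auto)
  then show "\<rho> (Yc (2*j) (2*j+1)) (tens (vac n c) 1) = smul (c (2*j) * c (2*j+1) / 2) (tens (vac n c') 1)"
    using dist c' unfolding sets by (simp add: algebra_simps)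
  have "\<rho> (Yc (2*j-1) (2*j+1)) (tens (vac n c) 1)
      = smul (1/2 * (\<Prod>l = 2*j-1..2*j+1. - \<i> * c' l)) (tens (vac n c') 1)"
    by (rule \<rho>_Yc_vac) (use j c flip in auto)
  then show "\<rho> (Yc (2*j-1) (2*j+1)) (tens (vac n c) 1)
      = smul (\<i> * c (2*j-1) * c (2*j) * c (2*j+1) / 2) (tens (vac n c') 1)"
    using dist c' unfolding sets by (simp add: algebra_simps)
  have "\<rho> (Yc (2*j) (2*j)) (tens (vac n c) 1)
      = smul (1/2 * (\<Prod>l = 2*j..2*j. - \<i> * c' l)) (tens (vac n c') 1)"
    by (rule \<rho>_Yc_vac) (use j c flip in auto)
  then show "\<rho> (Yc (2*j) (2*j)) (tens (vac n c) 1) = smul (- \<i> * c (2*j) / 2) (tens (vac n c') 1)"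
    by (simp add: c')
qed

lemmas ghat_closed =
  cvs.subspace_add[OF subspace_ghat] cvs.subspace_diff[OF subspace_ghat] cvs.subspace_scale[OF subspace_ghat]

lemmas \<rho>_linear_left = \<rho>_add_left \<rho>_diff_left \<rho>_smul_left

text \<open>
  A mode of degree \<open>1\<close> lowers the degree in the variables, and \<open>v(c) \<otimes> 1\<close> has degree \<open>0\<close>.
\<close>

lemma chev_e_0_vac:
  assumes "1 \<le> n" "sign_family n c"
  shows "\<rho> (chev_e n m 0) (tens (vac n c) 1) = 0"
proof -
  let ?\<alpha> = "simple_root 1"
  define X where "X = loop (Xvec ?\<alpha> + smul ((-1) powi 1) (Xvec (- ?\<alpha>))) 1"
  have \<alpha>: "?\<alpha> \<in> roots n"
    using chain_root_in_roots[of 1 1 n] assms by (simp add: chain_root_def)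
  have H: "Hvec ?\<alpha> \<in> cartan n"
    using assms by (auto simp: Hvec_def simple_root_def cartan_def in_keys_iff lookup_single when_def split: if_splits)
  have in_ghat: "X \<in> ghat_carrier n" "loop (Hvec ?\<alpha>) 1 \<in> ghat_carrier n"
    unfolding X_def by (rule loop_root_in_ghat[OF \<alpha>], rule loop_cartan_in_ghat[OF H]) simp
  have "\<rho> X (tens (vac n c) 1) = 0"
    using \<rho>_root_vac[OF \<alpha> assms(2) one_in_pol_carrier, of 1] by (simp add: X_def vertex_coeff_one tens_bilinear)
  moreover have "\<rho> (loop (Hvec ?\<alpha>) 1) (tens (vac n c) 1) = 0"
    by (subst \<rho>_cartan_vac[OF H _ one_in_pol_carrier]) (simp_all add: heis_def tens_bilinear pdiff_one del: One_nat_def)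
  moreover have "chev_e n m 0 = smul (\<i> / 2) X + smul (1/2) (loop (Hvec ?\<alpha>) 1)"
    by (rule ghat_eqI) (simp_all add: X_def chev_e_def lookup_add lookup_minus field_simps)
  ultimately show ?thesis using in_ghat
    by (simp add: \<rho>_linear_left ghat_closed tens_vac_in_fock one_in_pol_carrier)
qed

text \<open>
  The coefficient survives only for \<open>(c\<^sub>2\<^sub>j\<^sub>-\<^sub>1, c\<^sub>2\<^sub>j\<^sub>+\<^sub>1) = (-1, 1)\<close>, which becomes \<open>(1, -1)\<close>: this is a
  raising operator of type \<open>\<epsilon>\<^sub>j - \<epsilon>\<^sub>j\<^sub>+\<^sub>1\<close> in the spin representation.
\<close>

lemma chev_e_mid_vac:
  assumes "1 \<le> j" "j < m" "2 * j + 1 \<le> n" "sign_family n c"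
  shows "\<rho> (chev_e n m j) (tens (vac n c) 1)
    = smul (c (2*j) / 4 * (c (2*j-1) - 1) * (c (2*j+1) + 1))
        (tens (vac n (c(2*j-1 := - c (2*j-1), 2*j+1 := - c (2*j+1)))) 1)"
proof -
  note Y = \<rho>_Yc_around_even[OF assms(1,3,4)]
  have "Yc (2*j-1) (2*j) \<in> ghat_carrier n" "Yc (2*j) (2*j+1) \<in> ghat_carrier n"
    "Yc (2*j-1) (2*j+1) \<in> ghat_carrier n" "Yc (2*j) (2*j) \<in> ghat_carrier n"
    by (rule Yc_in_ghat; use assms in simp)+
  then have "\<rho> (chev_e n m j) (tens (vac n c) 1) = smul (1/2)
      (\<rho> (Yc (2*j-1) (2*j)) (tens (vac n c) 1) - \<rho> (Yc (2*j) (2*j+1)) (tens (vac n c) 1)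
       - smul \<i> (\<rho> (Yc (2*j-1) (2*j+1)) (tens (vac n c) 1)) - smul \<i> (\<rho> (Yc (2*j) (2*j)) (tens (vac n c) 1)))"
    using assms(1,2) by (simp add: chev_e_def \<rho>_linear_left ghat_closed tens_vac_in_fock one_in_pol_carrier)
  also have "\<dots> = smul (c (2*j) / 4 * (c (2*j-1) - 1) * (c (2*j+1) + 1))
        (tens (vac n (c(2*j-1 := - c (2*j-1), 2*j+1 := - c (2*j+1)))) 1)"
    unfolding Y cvs.scale_left_diff_distrib[symmetric] cvs.scale_scale
    by (rule arg_cong2[where f = smul]) (simp_all add: field_simps)
  finally show ?thesis .
qed

text \<open>
  Here the coefficient survives only if both of the last two odd signs are \<open>-1\<close>, as for a raising
  operator of type \<open>\<epsilon>\<^sub>m\<^sub>-\<^sub>1 + \<epsilon>\<^sub>m\<close>.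
\<close>

lemma chev_e_last_vac_odd:
  assumes "2 \<le> m" "n = 2 * m - 1" "sign_family n c"
  shows "\<rho> (chev_e n m m) (tens (vac n c) 1)
    = smul (- c (2*m-2) / 4 * (c (2*m-3) - 1) * (c (2*m-1) - 1))
        (tens (vac n (c(2*m-3 := - c (2*m-3), 2*m-1 := - c (2*m-1)))) 1)"
proof -
  have ix: "2 * (m - 1) = 2 * m - 2" "2 * m - 2 - 1 = 2 * m - 3" "2 * m - 2 + 1 = 2 * m - 1"
    using assms by auto
  have "1 \<le> m - 1" "2 * (m - 1) + 1 \<le> n" using assms by auto
  note Y = \<rho>_Yc_around_even[OF this assms(3), unfolded ix]
  have "Yc (2*m-3) (2*m-2) \<in> ghat_carrier n" "Yc (2*m-2) (2*m-1) \<in> ghat_carrier n"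
    "Yc (2*m-3) (2*m-1) \<in> ghat_carrier n" "Yc (2*m-2) (2*m-2) \<in> ghat_carrier n"
    by (rule Yc_in_ghat; use assms in simp)+
  moreover have "chev_e n m m = smul (1/2) (Yc (2*m-3) (2*m-2) + Yc (2*m-2) (2*m-1)
      + smul \<i> (Yc (2*m-3) (2*m-1)) - smul \<i> (Yc (2*m-2) (2*m-2)))"
    using assms(1,2) by (auto simp: chev_e_def)
  ultimately have "\<rho> (chev_e n m m) (tens (vac n c) 1) = smul (1/2)
      (\<rho> (Yc (2*m-3) (2*m-2)) (tens (vac n c) 1) + \<rho> (Yc (2*m-2) (2*m-1)) (tens (vac n c) 1)
       + smul \<i> (\<rho> (Yc (2*m-3) (2*m-1)) (tens (vac n c) 1)) - smul \<i> (\<rho> (Yc (2*m-2) (2*m-2)) (tens (vac n c) 1)))"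
    by (simp add: \<rho>_linear_left ghat_closed tens_vac_in_fock one_in_pol_carrier)
  also have "\<dots> = smul (- c (2*m-2) / 4 * (c (2*m-3) - 1) * (c (2*m-1) - 1))
        (tens (vac n (c(2*m-3 := - c (2*m-3), 2*m-1 := - c (2*m-1)))) 1)"
    unfolding Y cvs.scale_left_diff_distrib[symmetric] cvs.scale_left_distrib[symmetric] cvs.scale_scale
    by (rule arg_cong2[where f = smul]) (simp_all add: field_simps)
  finally show ?thesis .
qed

lemma chev_e_last_vac_even:
  assumes "2 \<le> m" "n = 2 * m" "sign_family n c"
  shows "\<rho> (chev_e n m m) (tens (vac n c) 1)
    = smul (c (2*m-2) / 2 * (c (2*m-1) - 1))
        (tens (vac n (c(2*m-3 := - c (2*m-3), 2*m-1 := - c (2*m-1)))) 1)"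
proof -
  have ix: "2 * (m - 1) = 2 * m - 2" "2 * m - 2 - 1 = 2 * m - 3" "2 * m - 2 + 1 = 2 * m - 1"
    using assms by auto
  have "1 \<le> m - 1" "2 * (m - 1) + 1 \<le> n" using assms by auto
  note Y = \<rho>_Yc_around_even[OF this assms(3), unfolded ix]
  have "Yc (2*m-2) (2*m-1) \<in> ghat_carrier n" "Yc (2*m-2) (2*m-2) \<in> ghat_carrier n"
    by (rule Yc_in_ghat; use assms in simp)+
  moreover have "chev_e n m m = Yc (2*m-2) (2*m-1) - smul \<i> (Yc (2*m-2) (2*m-2))"
    using assms(1,2) by (auto simp: chev_e_def)
  ultimately have "\<rho> (chev_e n m m) (tens (vac n c) 1) = 
      \<rho> (Yc (2*m-2) (2*m-1)) (tens (vac n c) 1) - smul \<i> (\<rho> (Yc (2*m-2) (2*m-2)) (tens (vac n c) 1))"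
    by (simp add: \<rho>_linear_left ghat_closed tens_vac_in_fock one_in_pol_carrier)
  also have "\<dots> = smul (c (2*m-2) / 2 * (c (2*m-1) - 1))
        (tens (vac n (c(2*m-3 := - c (2*m-3), 2*m-1 := - c (2*m-1)))) 1)"
    unfolding Y cvs.scale_left_diff_distrib[symmetric] cvs.scale_scale
    by (rule arg_cong2[where f = smul]) (simp_all add: field_simps)
  finally show ?thesis .
qed

lemma chev_h_vac:
  assumes m: "2 \<le> m" and n: "n = 2 * m - 1 \<or> n = 2 * m" and j: "j \<le> m" and c: "sign_family n c"
  shows "\<rho> (chev_h n m j) (tens (vac n c) 1) = smul
    (if j = 0 then (1 - c 1) / 2
     else if j < m then (c (2*j-1) - c (2*j+1)) / 2
     else if n = 2 * m then c (2*m-1)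
     else (c (2*m-3) + c (2*m-1)) / 2) (tens (vac n c) 1)"
proof -
  note simps = chev_h_def \<rho>_linear_left ghat_closed tens_vac_in_fock one_in_pol_carrier
  have Y: "\<rho> (Yc l l) (tens (vac n c) 1) = smul (- \<i> / 2 * c l) (tens (vac n c) 1)"
    and Y_in: "Yc l l \<in> ghat_carrier n" if "l \<in> {1..n}" "odd l" for l
    using \<rho>_Yc_odd[OF that c] Yc_in_ghat[of l l] that by auto
  consider "j = 0" | "0 < j" "j < m" | "j = m" "n = 2 * m" | "j = m" "n = 2 * m - 1"
    using j n by linarith
  then show ?thesis
  proof cases
    case 1
    have one: "1 \<in> {1..n}" "odd (1::nat)" using m n by auto
    have Y1: "Y (simple_root 1) = Yc 1 1" by (simp add: Yc_def chain_root_def)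
    have "\<rho> (chev_h n m j) (tens (vac n c) 1)
        = smul (- \<i>) (\<rho> (Yc 1 1) (tens (vac n c) 1)) + smul (1/2) (tens (vac n c) 1)"
      using 1 Y_in[OF one] by (simp add: simps Y1 Kvec_in_ghat \<rho>_Kvec_vac del: One_nat_def)
    also have "\<dots> = smul ((1 - c 1) / 2) (tens (vac n c) 1)"
      unfolding Y[OF one] cvs.scale_left_distrib[symmetric] cvs.scale_scale
      by (rule arg_cong2[where f = smul]) (simp_all add: field_simps)
    finally show ?thesis using 1 by simp
  next
    case 2
    have l: "2*j-1 \<in> {1..n}" "odd (2*j-1)" "2*j+1 \<in> {1..n}" "odd (2*j+1)"
      using 2 n by auto
    have "\<rho> (chev_h n m j) (tens (vac n c) 1)
        = smul \<i> (\<rho> (Yc (2*j-1) (2*j-1)) (tens (vac n c) 1) - \<rho> (Yc (2*j+1) (2*j+1)) (tens (vac n c) 1))"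
      using 2 Y_in[OF l(1,2)] Y_in[OF l(3,4)] by (simp add: simps)
    also have "\<dots> = smul ((c (2*j-1) - c (2*j+1)) / 2) (tens (vac n c) 1)"
      unfolding Y[OF l(1,2)] Y[OF l(3,4)] cvs.scale_left_diff_distrib[symmetric] cvs.scale_scale
      by (rule arg_cong2[where f = smul]) (simp_all add: field_simps)
    finally show ?thesis using 2 by simp
  next
    case 3
    have l: "2*m-1 \<in> {1..n}" "odd (2*m-1)"
      using 3 m by auto
    have "\<rho> (chev_h n m j) (tens (vac n c) 1) = smul (2 * \<i>) (\<rho> (Yc (2*m-1) (2*m-1)) (tens (vac n c) 1))"
    proof -
      have "chev_h n m j = smul (2 * \<i>) (Yc (2*m-1) (2*m-1))"
        using 3 m by (simp add: chev_h_def)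
      then show ?thesis using Y_in[OF l] by (simp add: simps)
    qed
    also have "\<dots> = smul (c (2*m-1)) (tens (vac n c) 1)"
      unfolding Y[OF l] cvs.scale_scale by (rule arg_cong2[where f = smul]) (simp_all add: field_simps)
    finally show ?thesis using 3 m by simp
  next
    case 4
    have l: "2*m-3 \<in> {1..n}" "odd (2*m-3)" "2*m-1 \<in> {1..n}" "odd (2*m-1)"
      using 4 m by auto
    have "\<rho> (chev_h n m j) (tens (vac n c) 1)
        = smul \<i> (\<rho> (Yc (2*m-3) (2*m-3)) (tens (vac n c) 1) + \<rho> (Yc (2*m-1) (2*m-1)) (tens (vac n c) 1))"
    proof -
      have "chev_h n m j = smul \<i> (Yc (2*m-3) (2*m-3) + Yc (2*m-1) (2*m-1))"
        using 4 m by (auto simp: chev_h_def)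
      then show ?thesis using Y_in[OF l(1,2)] Y_in[OF l(3,4)] by (simp add: simps)
    qed
    also have "\<dots> = smul ((c (2*m-3) + c (2*m-1)) / 2) (tens (vac n c) 1)"
      unfolding Y[OF l(1,2)] Y[OF l(3,4)] cvs.scale_left_distrib[symmetric] cvs.scale_scale
      by (rule arg_cong2[where f = smul]) (simp_all add: field_simps)
    finally show ?thesis using 4 m by auto
  qed
qed

lemma weight_vector_vac:
  assumes "2 \<le> m" "n = 2 * m - 1 \<or> n = 2 * m" "sign_family n c"
  shows "weight_vector n m \<rho> (tens (vac n c) 1)"
proof -
  have "\<rho> Dvec (tens (vac n c) 1) = smul 0 (tens (vac n c) 1)"
    by (simp add: \<rho>_Dvec_vac one_in_pol_carrier tens_bilinear)
  then show ?thesis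
    using chev_h_vac[OF assms(1,2) _ assms(3)]
    unfolding weight_vector_def
    by (auto simp: tens_vac_in_fock one_in_pol_carrier tens_vac_one_nonzero simp del: cvs.scale_zero_left)
qed

text \<open>
  Every \<open>v(c)\<close> is a weight vector, and \<open>e\<^sub>0\<close> kills it; each remaining \<open>e\<^sub>j\<close> forbids one sign pattern.
\<close>

lemma singular_vector_vac_iff:
  assumes m: "2 \<le> m" and n: "n = 2 * m - 1 \<or> n = 2 * m" and c: "sign_family n c"
  shows "singular_vector n m \<rho> (tens (vac n c) 1) \<longleftrightarrow>
    (\<forall>j\<in>{1..<m}. c (2*j-1) = 1 \<or> c (2*j+1) = -1) \<and>
    (c (2*m-1) = 1 \<or> n = 2 * m - 1 \<and> c (2*m-3) = 1)"
proof -
  have c_nz: "c l \<noteq> 0" if "l \<in> {1..n}" for l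
    using c that by (auto simp: sign_family_def dest: bspec[of _ _ l])
  have mid: "\<rho> (chev_e n m j) (tens (vac n c) 1) = 0 \<longleftrightarrow> c (2*j-1) = 1 \<or> c (2*j+1) = -1"
    if "j \<in> {1..<m}" for j
  proof -
    have "2 * j \<in> {1..n}" "2 * j + 1 \<le> n" using that n by auto
    then show ?thesis
      using chev_e_mid_vac[of j m c] that c c_nz[of "2 * j"]
      by (simp add: tens_vac_one_nonzero add_eq_0_iff2)
  qed
  have last: "\<rho> (chev_e n m m) (tens (vac n c) 1) = 0 \<longleftrightarrow> c (2*m-1) = 1 \<or> n = 2 * m - 1 \<and> c (2*m-3) = 1"
  proof -
    have "2 * m - 2 \<in> {1..n}" using m n by auto
    then have nz: "c (2 * m - 2) \<noteq> 0" by (rule c_nz)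
    from n show ?thesis
    proof
      assume n: "n = 2 * m - 1"
      have "\<rho> (chev_e n m m) (tens (vac n c) 1) = 0 \<longleftrightarrow> c (2*m-3) = 1 \<or> c (2*m-1) = 1"
        unfolding chev_e_last_vac_odd[OF m n c] cvs.scale_eq_0_iff using nz by (simp add: tens_vac_one_nonzero)
      then show ?thesis using n by auto
    next
      assume n: "n = 2 * m"
      have "\<rho> (chev_e n m m) (tens (vac n c) 1) = 0 \<longleftrightarrow> c (2*m-1) = 1"
        unfolding chev_e_last_vac_even[OF m n c] cvs.scale_eq_0_iff using nz by (simp add: tens_vac_one_nonzero)
      then show ?thesis using n m by auto
    qed
  qed
  have "{0..m} = insert 0 (insert m {1..<m})" using m by auto
  then show ?thesis
    using weight_vector_vac[OF m n c] chev_e_0_vac[of c m] m n c mid last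
    unfolding singular_vector_def by auto
qed

end

text \<open>
  If no \<open>-1\<close> is directly followed by a \<open>1\<close> among the odd signs, then a \<open>1\<close> at the top forces
  all signs below it to be \<open>1\<close>.
\<close>

lemma signs_propagate:
  fixes c :: "nat \<Rightarrow> complex" and j p :: nat
  assumes step: "\<And>j. 1 \<le> j \<Longrightarrow> j < p \<Longrightarrow> c (2*j-1) = 1 \<or> c (2*j+1) = -1"
    and top: "c (2*p-1) = 1"
  shows "j \<in> {1..p} \<Longrightarrow> c (2*j-1) = 1"
proof (induction "p - j" arbitrary: j)
  case 0
  then show ?case using top by simp
next
  case (Suc d)
  then have "c (2 * Suc j - 1) = 1" by (intro Suc.hyps(1)) auto
  then show ?case using step[of j] Suc by auto
qed

section \<open>Irreducibility\<close>

definition monom_degree :: "('a \<Rightarrow>\<^sub>0 nat) \<Rightarrow> nat" where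
  "monom_degree N = (\<Sum>p\<in>keys N. lookup N p)"

lemma monom_degree_add: "monom_degree (M + N) = monom_degree M + monom_degree N"
  unfolding monom_degree_def by (rule setsum_keys_plus_distrib) simp_all

lemma monom_degree_single [simp]: "monom_degree (Poly_Mapping.single p k) = k"
  by (simp add: monom_degree_def)

lemma monom_degree_eq_0_iff: "monom_degree N = 0 \<longleftrightarrow> N = 0"
proof
  assume "monom_degree N = 0"
  then have "lookup N p = 0" if "p \<in> keys N" for p using that by (simp add: monom_degree_def)
  then show "N = 0" by (intro poly_mapping_eqI) (auto simp: in_keys_iff)
qed (simp add: monom_degree_def)

lemma monom_nonzero_key:
  assumes "N \<noteq> (0 :: nat \<times> nat \<Rightarrow>\<^sub>0 nat)"
  obtains k r where "(k, r) \<in> keys N"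
proof -
  have "\<exists>p. lookup N p \<noteq> 0" using assms by (auto intro: poly_mapping_eqI)
  then show thesis using that by (auto simp: in_keys_iff)
qed

lemma monom_split:
  assumes "p \<in> keys N"
  obtains N' where "N = N' + Poly_Mapping.single p (1::nat)" "keys N' \<subseteq> keys N"
proof
  show "N = (N - Poly_Mapping.single p 1) + Poly_Mapping.single p 1"
    by (rule poly_mapping_eqI)
      (use assms in \<open>auto simp: lookup_add lookup_minus lookup_single when_def in_keys_iff\<close>)
qed (rule keys_minus_subset)

text \<open>
  The families \<open>b\<close> that index the vectors \<open>v(b)\<close> of one irreducible component. The last condition covers both
  parities of \<open>n\<close>. A flip by an even simple root changes an odd sign together with the next one, so
  the odd signs below \<open>n\<close> can be corrected from left to right; when \<open>n\<close> is odd, nothing corrects the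
  sign at \<open>n\<close>, and it has to be determined by the others.
\<close>

locale sign_component = twisted_vertex_module +
  fixes B :: "(nat \<Rightarrow> complex) set"
  assumes nonempty: "B \<noteq> {}"
    and signs: "b \<in> B \<Longrightarrow> sign_family n b"
    and even_fixed: "b \<in> B \<Longrightarrow> b' \<in> B \<Longrightarrow> l \<in> {1..n} \<Longrightarrow> even l \<Longrightarrow> b l = b' l"
    and flip_closed: "b \<in> B \<Longrightarrow> \<alpha> \<in> roots n \<Longrightarrow> (\<lambda>l. flip \<alpha> l * b l) \<in> B"
    and determined: "b \<in> B \<Longrightarrow> b' \<in> B \<Longrightarrow> (\<And>l. odd l \<Longrightarrow> l < n \<Longrightarrow> b l = b' l)
      \<Longrightarrow> odd l \<Longrightarrow> l \<in> {1..n} \<Longrightarrow> b l = b' l"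
begin

abbreviation "U \<equiv> cvs.span (vac n ` B)"
abbreviation "W \<equiv> tensor_space U (pol_carrier n)"

lemma subspace_W: "cvs.subspace W"
  by (rule subspace_tensor_space)

lemma W_least:
  assumes "cvs.subspace X" "\<And>b f. b \<in> B \<Longrightarrow> f \<in> pol_carrier n \<Longrightarrow> tens (vac n b) f \<in> X"
  shows "W \<subseteq> X"
  by (rule tensor_space_span_least) (use assms in auto)

lemma W_subset_fock: "W \<subseteq> fock_carrier n"
  by (rule W_least) (auto simp: subspace_fock tens_vac_in_fock)

lemma vac_tens_in_W: "b \<in> B \<Longrightarrow> f \<in> pol_carrier n \<Longrightarrow> tens (vac n b) f \<in> W"
  by (intro tens_in_tensor_space cvs.span_base imageI)

lemma W_invariant_of_vac:
  assumes x: "x \<in> ghat_carrier n"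
    and gen: "\<And>b f. b \<in> B \<Longrightarrow> f \<in> pol_carrier n \<Longrightarrow> \<rho> x (tens (vac n b) f) \<in> W"
    and w: "w \<in> W"
  shows "\<rho> x w \<in> W"
proof -
  have "W \<subseteq> {w \<in> fock_carrier n. \<rho> x w \<in> W}"
  proof (rule W_least)
    show "cvs.subspace {w \<in> fock_carrier n. \<rho> x w \<in> W}"
      using x subspace_W subspace_fock
      by (auto intro!: cvs.subspaceI simp: \<rho>_0_right \<rho>_add_right \<rho>_smul_right
          cvs.subspace_0 cvs.subspace_add cvs.subspace_scale)
  qed (simp add: tens_vac_in_fock gen)
  with w show ?thesis by blast
qed

lemma loop_root_invariant:
  assumes "\<alpha> \<in> roots n" "w \<in> W"
  shows "\<rho> (loop (Xvec \<alpha> + smul ((-1) powi j) (Xvec (- \<alpha>))) j) w \<in> W"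
  by (rule W_invariant_of_vac[OF loop_root_in_ghat[OF assms(1)] _ assms(2)])
    (simp add: \<rho>_root_vac assms(1) signs cvs.subspace_scale[OF subspace_W] vac_tens_in_W flip_closed
      vertex_coeff_in_pol_carrier)

lemma loop_cartan_invariant:
  assumes "H \<in> cartan n" "odd j" "w \<in> W"
  shows "\<rho> (loop H j) w \<in> W"
proof (rule W_invariant_of_vac[OF loop_cartan_in_ghat[OF assms(1,2)] _ assms(3)])
  fix b f assume b: "b \<in> B" and f: "f \<in> pol_carrier n"
  have "smul (1 / of_real (sqrt 2)) (\<Sum>k = 1..n. smul (g_form H (S k)) (heis k j f)) \<in> pol_carrier n"
    using assms(2) f
    by (intro cvs.subspace_scale[OF subspace_pol_carrier] cvs.subspace_sum[OF subspace_pol_carrier]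
        heis_in_pol_carrier)
  then show "\<rho> (loop H j) (tens (vac n b) f) \<in> W"
    unfolding \<rho>_cartan_vac[OF assms(1,2) f] by (rule vac_tens_in_W[OF b])
qed

text \<open>
  An element with \<open>\<sigma> x = \<plusminus> x\<close> equals \<open>(x \<plusminus> \<sigma> x)/2\<close>. Expanding \<open>x\<close> in the basis turns this into a
  combination of the elements on which the action is prescribed.
\<close>

lemma loop_invariant:
  assumes x: "x \<in> g_graded n j" and w: "w \<in> W"
  shows "loop x j \<in> ghat_carrier n" "\<rho> (loop x j) w \<in> W"
proof -
  let ?s = "(-1) powi j :: complex"
  let ?p = "\<lambda>a. Poly_Mapping.single a 1 + smul ?s (sigma_basis a)"
  let ?L = "{y \<in> ghat_carrier n. \<rho> y w \<in> W}"
  have w': "w \<in> fock_carrier n" using w W_subset_fock by blast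
  have L: "cvs.subspace ?L"
    using w' subspace_W subspace_ghat
    by (auto intro!: cvs.subspaceI simp: \<rho>_0_left \<rho>_add_left \<rho>_smul_left
        cvs.subspace_0 cvs.subspace_add cvs.subspace_scale)
  have ss: "?s * ?s = 1" by (simp add: power_int_minus_left)
  have "x + smul ?s (sigma x) = smul 2 x"
    using x ss by (simp add: g_graded_def cvs.scale_left_distrib[of 1 1, simplified])
  then have "x = smul (1/2) (x + smul ?s (sigma x))" by simp
  also have "x + smul ?s (sigma x) = (\<Sum>a\<in>keys x. smul (lookup x a) (?p a))"
    using sum_smul_single[of "keys x" x]
    by (simp add: sigma_def linext_def cvs.scale_right_distrib sum.distrib cvs.scale_sum_right mult.commute)
  finally have x_eq: "x = smul (1/2) (\<Sum>a\<in>keys x. smul (lookup x a) (?p a))" .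
  have "loop (?p a) j \<in> ?L" if "a \<in> keys x" for a
  proof (cases a)
    case (Hb k)
    then have k: "k \<in> {1..n}" using x that by (auto simp: g_graded_def galg_carrier_def)
    show ?thesis
    proof (cases "even j")
      case True
      then show ?thesis using cvs.subspace_0[OF L] by (simp add: Hb power_int_minus_left loop_0)
    next
      case False
      have H: "Poly_Mapping.single (Hb k) 1 \<in> cartan n"
        using k by (auto simp: cartan_def)
      have "?p a = smul 2 (Poly_Mapping.single (Hb k) 1)"
        using False by (simp add: Hb power_int_minus_left cvs.scale_left_distrib[of 1 1, simplified])
      then show ?thesis
        using loop_cartan_in_ghat[OF H False] loop_cartan_invariant[OF H False w] 
        by (simp add: loop_smul cvs.subspace_scale[OF L, simplified])
    qed
  next
    case (Xb \<alpha>)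
    then have "\<alpha> \<in> roots n" using x that by (auto simp: g_graded_def galg_carrier_def)
    then show ?thesis
      using loop_root_in_ghat[of \<alpha> j] loop_root_invariant[OF _ w, of \<alpha> j] by (simp add: Xb Xvec_def)
  qed
  then have "loop x j \<in> ?L"
    by (subst x_eq) (auto simp only: loop_smul loop_sum intro!: cvs.subspace_scale[OF L] cvs.subspace_sum[OF L])
  then show "loop x j \<in> ghat_carrier n" "\<rho> (loop x j) w \<in> W" by auto
qed

lemma W_invariant:
  assumes x: "x \<in> ghat_carrier n" and w: "w \<in> W"
  shows "\<rho> x w \<in> W"
proof -
  let ?L = "{y \<in> ghat_carrier n. \<rho> y w \<in> W}"
  have w': "w \<in> fock_carrier n" using w W_subset_fock by blast
  have L: "cvs.subspace ?L"
    using w' subspace_W subspace_ghat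
    by (auto intro!: cvs.subspaceI simp: \<rho>_0_left \<rho>_add_left \<rho>_smul_left
        cvs.subspace_0 cvs.subspace_add cvs.subspace_scale)
  have "\<rho> Kvec w \<in> W"
    by (rule W_invariant_of_vac[OF Kvec_in_ghat _ w]) (simp add: \<rho>_Kvec_vac vac_tens_in_W)
  moreover have "\<rho> Dvec w \<in> W"
    by (rule W_invariant_of_vac[OF Dvec_in_ghat _ w])
      (simp add: \<rho>_Dvec_vac vac_tens_in_W euler_in_pol_carrier cvs.subspace_neg[OF subspace_pol_carrier])
  ultimately have "{loop x j | x j. x \<in> g_graded n j} \<union> {Kvec, Dvec} \<subseteq> ?L"
    using loop_invariant[OF _ w] Kvec_in_ghat Dvec_in_ghat by auto
  then have "cvs.span ({loop x j | x j. x \<in> g_graded n j} \<union> {Kvec, Dvec}) \<subseteq> ?L"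
    using L by (rule cvs.span_minimal)
  moreover have "x \<in> cvs.span ({loop x j | x j. x \<in> g_graded n j} \<union> {Kvec, Dvec})"
    using x by (simp only: ghat_carrier_def)
  ultimately show ?thesis by blast
qed

lemma lie_module_W: "lie_module (ghat_carrier n) (ghat_bracket n) \<rho> W"
  using lie_module_fock W_subset_fock W_invariant subspace_W
  unfolding lie_module_def by (simp add: subset_iff)

text \<open>Up to a factor, \<open>S\<^sub>k \<otimes> t\<^sup>r\<close> acts as differentiation in \<open>x\<close> with indices \<open>(k, r)\<close>.\<close>

lemma lookup_\<rho>_S:
  assumes k: "k \<in> {1..n}" and r: "odd r" and w: "w \<in> W"
  shows "lookup (\<rho> (loop (S k) (int r)) w) (\<gamma>, N)
    = of_nat (Suc (lookup N (k, r))) / of_real (sqrt 2) * lookup w (\<gamma>, N + Poly_Mapping.single (k, r) 1)"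
proof -
  have r': "odd (int r)" "int r > 0" using r by (auto simp: odd_pos)
  have x: "loop (S k) (int r) \<in> ghat_carrier n"
    by (rule loop_cartan_in_ghat[OF S_in_cartan[OF k] r'(1)])
  define q where "q N = (of_nat (Suc (lookup N (k, r))) / of_real (sqrt 2) :: complex)"
    for N :: "nat \<times> nat \<Rightarrow>\<^sub>0 nat"
  let ?P = "\<lambda>w. \<forall>\<gamma> N. lookup (\<rho> (loop (S k) (int r)) w) (\<gamma>, N)
    = q N * lookup w (\<gamma>, N + Poly_Mapping.single (k, r) 1)"
  have "W \<subseteq> {w \<in> fock_carrier n. ?P w}"
  proof (rule W_least)
    show "cvs.subspace {w \<in> fock_carrier n. ?P w}"
      using x subspace_fock
      by (auto intro!: cvs.subspaceI simp: \<rho>_0_right \<rho>_add_right \<rho>_smul_right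
          cvs.subspace_0 cvs.subspace_add cvs.subspace_scale lookup_add algebra_simps)
  next
    fix b f assume b: "b \<in> B" and f: "f \<in> pol_carrier n"
    have "heis k (int r) f = pdiff k r f" using r' by (simp add: heis_def)
    then show "tens (vac n b) f \<in> {w \<in> fock_carrier n. ?P w}"
      by (simp add: q_def tens_vac_in_fock f \<rho>_S_vac[OF k r'(1) f] lookup_pdiff)
  qed
  with w show ?thesis unfolding q_def by blast
qed

lemma keys_W:
  assumes "w \<in> W" "(\<gamma>, N) \<in> keys w"
  shows "keys N \<subseteq> {1..n} \<times> {r. odd r}"
proof -
  let ?P = "\<lambda>w. \<forall>\<gamma> N. lookup w (\<gamma>, N) \<noteq> 0 \<longrightarrow> keys N \<subseteq> {1..n} \<times> {r. odd r}"
  have "W \<subseteq> {w. ?P w}"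
  proof (rule W_least)
    show "cvs.subspace {w :: fock. ?P w}"
    proof (rule cvs.subspaceI)
      fix x y :: fock assume "x \<in> {w. ?P w}" "y \<in> {w. ?P w}"
      moreover have "lookup x p \<noteq> 0 \<or> lookup y p \<noteq> 0" if "lookup (x + y) p \<noteq> 0" for p
        using that by (auto simp: lookup_add)
      ultimately show "x + y \<in> {w. ?P w}" by blast
    qed auto
  next
    fix b f assume "f \<in> pol_carrier n"
    then show "tens (vac n b) f \<in> {w. ?P w}"
      by (auto simp: pol_carrier_def in_keys_iff)
  qed
  with assms show ?thesis by (auto simp: in_keys_iff)
qed

text \<open>
  Extracting the coefficient of the monomial \<open>1\<close> is linear and maps each generator \<open>v(b) \<otimes> f\<close> of \<open>W\<close> to a
  multiple of \<open>v(b)\<close>.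
\<close>

lemma constant_part_in_U:
  assumes w: "w \<in> W" and const: "\<And>\<gamma> N. (\<gamma>, N) \<in> keys w \<Longrightarrow> N = 0"
  obtains u where "u \<in> U" "w = tens u 1"
proof -
  let ?c = "\<lambda>w :: fock. Poly_Mapping.map_key (\<lambda>\<gamma>. (\<gamma>, 0)) w"
  have inj: "inj (\<lambda>\<gamma> :: lat2. (\<gamma>, 0 :: nat \<times> nat \<Rightarrow>\<^sub>0 nat))" by (rule injI) simp
  have lookup_c: "lookup (?c w) \<gamma> = lookup w (\<gamma>, 0)" for w :: fock and \<gamma>
    using map_key.rep_eq[OF inj, of w] by simp
  have "W \<subseteq> {w. ?c w \<in> U}"
  proof (rule W_least)
    have "?c 0 = 0" "?c (x + y) = ?c x + ?c y" "?c (smul a x) = smul a (?c x)" for x y :: fock and a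
      by (rule poly_mapping_eqI; simp add: lookup_c lookup_add)+
    then show "cvs.subspace {w. ?c w \<in> U}"
      by (intro cvs.subspaceI) (auto intro: cvs.span_zero cvs.span_add cvs.span_scale)
  next
    fix b f assume "b \<in> B"
    have "?c (tens (vac n b) f) = smul (lookup f 0) (vac n b)"
      by (rule poly_mapping_eqI) (simp add: lookup_c)
    then show "tens (vac n b) f \<in> {w. ?c w \<in> U}"
      using \<open>b \<in> B\<close> by (auto intro: cvs.span_scale cvs.span_base)
  qed
  then have "?c w \<in> U" using w by blast
  moreover have "w = tens (?c w) 1"
  proof (rule poly_mapping_eqI)
    show "lookup w p = lookup (tens (?c w) 1) p" for p
      using const[of "fst p" "snd p"]
      by (cases p) (auto simp: lookup_c lookup_one when_def in_keys_iff)
  qed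
  ultimately show thesis by (rule that)
qed

end

context sign_component
begin

text \<open>
  As long as a variable occurs in an element, the corresponding \<open>S\<^sub>k \<otimes> t\<^sup>r\<close> maps it to a nonzero
  element of the submodule of smaller degree.
\<close>

lemma submodule_constants:
  assumes M: "submodule (ghat_carrier n) \<rho> W M" and w: "w \<in> M" "w \<noteq> 0"
  shows "\<exists>u\<in>U. u \<noteq> 0 \<and> tens u 1 \<in> M"
proof -
  have MW: "M \<subseteq> W" and inv: "\<And>x v. x \<in> ghat_carrier n \<Longrightarrow> v \<in> M \<Longrightarrow> \<rho> x v \<in> M"
    using M by (auto simp: submodule_def)
  have "(\<And>\<gamma> N. (\<gamma>, N) \<in> keys w \<Longrightarrow> monom_degree N \<le> d) \<Longrightarrow> ?thesis" for d
    using w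
  proof (induction d arbitrary: w)
    case (0 w)
    have "N = 0" if "(\<gamma>, N) \<in> keys w" for \<gamma> N
      using 0(1)[OF that] by (simp add: monom_degree_eq_0_iff)
    then obtain u where u: "u \<in> U" "w = tens u 1"
      using constant_part_in_U[of w] 0 MW by blast
    have "u \<noteq> 0" using 0(3) u(2) by (auto simp: tens_bilinear)
    then show ?case using 0(2) u by blast
  next
    case (Suc d w)
    show ?case
    proof (cases "\<forall>\<gamma> N. (\<gamma>, N) \<in> keys w \<longrightarrow> N = 0")
      case True
      then obtain u where u: "u \<in> U" "w = tens u 1"
        using constant_part_in_U[of w] Suc.prems MW by blast
      have "u \<noteq> 0" using Suc.prems(3) u(2) by (auto simp: tens_bilinear)
      then show ?thesis using Suc.prems(2) u by blast
    next
      case False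
      then obtain \<gamma> N where N: "(\<gamma>, N) \<in> keys w" "N \<noteq> 0" by blast
      obtain k r where kr: "(k, r) \<in> keys N" by (rule monom_nonzero_key[OF N(2)])
      have w: "w \<in> W" using Suc.prems MW by blast
      have "(k, r) \<in> {1..n} \<times> {r. odd r}"
        using keys_W[OF w N(1)] kr by (rule subsetD)
      then have k: "k \<in> {1..n}" and r: "odd r" by auto
      obtain N' where N': "N = N' + Poly_Mapping.single (k, r) 1"
        using monom_split[OF kr] by blast
      let ?w = "\<rho> (loop (S k) (int r)) w"
      note lookup = lookup_\<rho>_S[OF k r w]
      show ?thesis
      proof (rule Suc.IH)
        show "?w \<in> M"
          by (intro inv loop_cartan_in_ghat S_in_cartan k Suc.prems) (simp add: r)
        have "lookup ?w (\<gamma>, N') \<noteq> 0"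
          using N(1) unfolding lookup N'[symmetric] by (simp add: in_keys_iff del: of_nat_Suc)
        then show "?w \<noteq> 0" by auto
      next
        fix \<delta> L assume "(\<delta>, L) \<in> keys ?w"
        then have "(\<delta>, L + Poly_Mapping.single (k, r) 1) \<in> keys w"
          by (auto simp: in_keys_iff lookup simp del: One_nat_def)
        then have "monom_degree (L + Poly_Mapping.single (k, r) 1) \<le> Suc d"
          by (rule Suc.prems)
        then show "monom_degree L \<le> d" by (simp add: monom_degree_add)
      qed
    qed
  qed
  moreover have "monom_degree N \<le> Max ((monom_degree \<circ> snd) ` keys w)" if "(\<gamma>, N) \<in> keys w" for \<gamma> N
    using that by (intro Max_ge) (auto intro!: image_eqI[of _ _ "(\<gamma>, N)"])
  ultimately show ?thesis by blast
qed

lemma Yc_eigenspace: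
  assumes l: "l \<in> {1..n}" "odd l" and C: "C \<subseteq> B" "\<And>b. b \<in> C \<Longrightarrow> b l = s"
    and u: "u \<in> cvs.span (vac n ` C)"
  shows "tens u 1 \<in> fock_carrier n \<and> \<rho> (Yc l l) (tens u 1) = smul (- \<i> / 2 * s) (tens u 1)"
  using u
proof (induction rule: cvs.span_induct_alt)
  case base
  have "Yc l l \<in> ghat_carrier n" using l by (intro Yc_in_ghat) auto
  then show ?case
    by (simp add: tens_bilinear \<rho>_0_right cvs.subspace_0[OF subspace_fock])
next
  case (step c x y)
  then obtain b where b: "b \<in> C" "x = vac n b" by auto
  have Y: "Yc l l \<in> ghat_carrier n" using l by (intro Yc_in_ghat) auto
  have "\<rho> (Yc l l) (tens x 1) = smul (- \<i> / 2 * s) (tens x 1)"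
    using \<rho>_Yc_odd[OF l signs] b C by auto
  moreover have "tens x 1 \<in> fock_carrier n" by (simp add: b tens_vac_in_fock one_in_pol_carrier)
  ultimately show ?case
    using step Y by (simp add: tens_bilinear \<rho>_add_right \<rho>_smul_right cvs.scale_right_distrib
      cvs.subspace_add[OF subspace_fock] cvs.subspace_scale[OF subspace_fock] mult_ac)
qed

text \<open>
  The element is split successively into eigenvectors of the \<open>Y\<^sub>l\<close> for \<open>l = 1, 3, 5, \<dots>\<close>. The
  eigenvalues are \<open>- i/2\<close> and \<open>i/2\<close>, so the components belong to the submodule, and one of them is nonzero. When all
  odd signs have been fixed, only multiples of a single \<open>v(b)\<close> are left.
\<close>

lemma submodule_vac:
  assumes M: "submodule (ghat_carrier n) \<rho> W M" and u: "u \<in> U" "u \<noteq> 0" "tens u 1 \<in> M"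
  shows "\<exists>b\<in>B. tens (vac n b) 1 \<in> M"
proof -
  have sub: "cvs.subspace M" and inv: "\<And>x v. x \<in> ghat_carrier n \<Longrightarrow> v \<in> M \<Longrightarrow> \<rho> x v \<in> M"
    using M by (auto simp: submodule_def)
  have "\<exists>s u. u \<in> cvs.span (vac n ` {b \<in> B. \<forall>l\<in>{1..p}. odd l \<longrightarrow> b l = s l}) \<and> u \<noteq> 0 \<and> tens u 1 \<in> M"
    if "p \<le> n" for p
    using that
  proof (induction p)
    case 0
    then show ?case using u by auto
  next
    case (Suc p)
    then obtain s u where u: "u \<in> cvs.span (vac n ` {b \<in> B. \<forall>l\<in>{1..p}. odd l \<longrightarrow> b l = s l})"
      "u \<noteq> 0" "tens u 1 \<in> M" by auto
    have Suc_p: "{1..Suc p} = insert (Suc p) {1..p}" by auto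
    show ?case
    proof (cases "odd (Suc p)")
      case False
      then have eq: "{b \<in> B. \<forall>l\<in>{1..Suc p}. odd l \<longrightarrow> b l = s l} = {b \<in> B. \<forall>l\<in>{1..p}. odd l \<longrightarrow> b l = s l}"
        unfolding Suc_p by simp
      show ?thesis
        by (rule exI[of _ s], rule exI[of _ u]) (simp only: eq u simp_thms)
    next
      case True
      have l: "Suc p \<in> {1..n}" using Suc.prems by simp
      let ?C = "\<lambda>e. {b \<in> B. \<forall>l\<in>{1..Suc p}. odd l \<longrightarrow> b l = (s(Suc p := e)) l}"
      have pm: "b (Suc p) = 1 \<or> b (Suc p) = -1" if "b \<in> B" for b
        using signs[OF that] l by (auto simp: sign_family_def dest: bspec[of _ _ "Suc p"])
      have in_C: "b \<in> ?C (b (Suc p))" if "b \<in> {b \<in> B. \<forall>l\<in>{1..p}. odd l \<longrightarrow> b l = s l}" for b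
        using that unfolding Suc_p by simp
      have subset: "{b \<in> B. \<forall>l\<in>{1..p}. odd l \<longrightarrow> b l = s l} \<subseteq> ?C 1 \<union> ?C (-1)"
      proof
        fix b assume b: "b \<in> {b \<in> B. \<forall>l\<in>{1..p}. odd l \<longrightarrow> b l = s l}"
        then have "b (Suc p) = 1 \<or> b (Suc p) = -1" using pm by blast
        then show "b \<in> ?C 1 \<union> ?C (-1)"
        proof
          assume "b (Suc p) = 1"
          with in_C[OF b] show ?thesis by (intro UnI1) (simp only:)
        next
          assume "b (Suc p) = -1"
          with in_C[OF b] show ?thesis by (intro UnI2) (simp only:)
        qed
      qed
      have "vac n ` {b \<in> B. \<forall>l\<in>{1..p}. odd l \<longrightarrow> b l = s l} \<subseteq> vac n ` ?C 1 \<union> vac n ` ?C (-1)"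
        unfolding image_Un[symmetric] by (rule image_mono[OF subset])
      then have "u \<in> cvs.span (vac n ` ?C 1 \<union> vac n ` ?C (-1))"
        using u(1) by (rule subsetD[OF cvs.span_mono])
      then obtain y z where y: "y \<in> cvs.span (vac n ` ?C 1)" and z: "z \<in> cvs.span (vac n ` ?C (-1))"
        and u_eq: "u = y + z"
        unfolding cvs.span_Un by blast
      let ?Y = "Yc (Suc p) (Suc p)"
      have Y: "?Y \<in> ghat_carrier n" using l by (intro Yc_in_ghat) auto
      have y': "tens y 1 \<in> fock_carrier n" "\<rho> ?Y (tens y 1) = smul (- \<i> / 2) (tens y 1)"
        using Yc_eigenspace[OF l True _ _ y, of 1] True by auto
      have z': "tens z 1 \<in> fock_carrier n" "\<rho> ?Y (tens z 1) = smul (\<i> / 2) (tens z 1)"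
        using Yc_eigenspace[OF l True _ _ z, of "-1"] True by auto
      have Yu: "\<rho> ?Y (tens u 1) = smul (- \<i> / 2) (tens y 1) + smul (\<i> / 2) (tens z 1)"
        using Y y' z' by (simp add: u_eq tens_bilinear \<rho>_add_right)
      \<comment> \<open>\<open>2 i Y\<close> is the identity on the first component and minus the identity on the second.\<close>
      have "tens y 1 = smul (1/2) (tens u 1 + smul (2 * \<i>) (\<rho> ?Y (tens u 1)))"
        "tens z 1 = smul (1/2) (tens u 1 - smul (2 * \<i>) (\<rho> ?Y (tens u 1)))"
        unfolding Yu unfolding u_eq by (rule poly_mapping_eqI; simp add: lookup_add lookup_minus tens_bilinear field_simps)+
      then have in_M: "tens y 1 \<in> M" "tens z 1 \<in> M"
        using u(3) inv[OF Y u(3)]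
        by (simp_all add: cvs.subspace_add[OF sub] cvs.subspace_diff[OF sub] cvs.subspace_scale[OF sub])
      have "y \<noteq> 0 \<or> z \<noteq> 0" using u(2) u_eq by auto
      then show ?thesis using in_M y z by blast
    qed
  qed
  from this[OF order_refl] obtain s u where
    u: "u \<in> cvs.span (vac n ` {b \<in> B. \<forall>l\<in>{1..n}. odd l \<longrightarrow> b l = s l})" "u \<noteq> 0" "tens u 1 \<in> M"
    by blast
  let ?C = "{b \<in> B. \<forall>l\<in>{1..n}. odd l \<longrightarrow> b l = s l}"
  have "?C \<noteq> {}"
  proof
    assume "?C = {}"
    then show False using u(1,2) by (simp only: image_empty cvs.span_empty) simp
  qed
  then obtain b where b: "b \<in> ?C" by blast
  have "vac n b' = vac n b" if "b' \<in> ?C" for b'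
  proof (rule vac_cong)
    fix l assume "l \<in> {1..n}"
    then show "b' l = b l" using that b even_fixed[of b' b l] by (cases "even l") auto
  qed
  then have "vac n ` ?C = {vac n b}" using b by blast
  then obtain a where a: "u = smul a (vac n b)"
    using u(1) by (auto simp: cvs.span_singleton)
  then have "a \<noteq> 0" using u(2) by auto
  then have "tens (vac n b) 1 = smul (1 / a) (tens u 1)"
    by (simp add: a tens_bilinear)
  then have "tens (vac n b) 1 \<in> M" using u(3) cvs.subspace_scale[OF sub] by metis
  then show ?thesis using b by blast
qed

text \<open>
  The odd signs of \<open>b\<close> are adjusted to those of \<open>b'\<close> from left to right: a wrong sign at \<open>2p + 1\<close> is
  corrected by the root \<open>\<alpha>\<^sub>2\<^sub>p\<^sub>+\<^sub>2\<close>, which otherwise affects only the sign at \<open>2p + 3\<close>.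
\<close>

lemma submodule_transitive:
  assumes M: "submodule (ghat_carrier n) \<rho> W M" and b: "b \<in> B" "tens (vac n b) 1 \<in> M" and b': "b' \<in> B"
  shows "tens (vac n b') 1 \<in> M"
proof -
  have sub: "cvs.subspace M" and inv: "\<And>x v. x \<in> ghat_carrier n \<Longrightarrow> v \<in> M \<Longrightarrow> \<rho> x v \<in> M"
    using M by (auto simp: submodule_def)
  have "\<exists>a\<in>B. tens (vac n a) 1 \<in> M \<and> (\<forall>l<2*p. odd l \<longrightarrow> a l = b' l)" if "2 * p \<le> n" for p
    using that
  proof (induction p)
    case 0
    then show ?case using b by auto
  next
    case (Suc p)
    then obtain a where a: "a \<in> B" "tens (vac n a) 1 \<in> M" "\<And>l. l < 2 * p \<Longrightarrow> odd l \<Longrightarrow> a l = b' l" by auto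
    have less: "l < 2 * Suc p \<and> odd l \<longleftrightarrow> l < 2 * p \<and> odd l \<or> l = 2 * p + 1" for l by presburger
    show ?case
    proof (cases "a (2 * p + 1) = b' (2 * p + 1)")
      case True
      then show ?thesis using a less by metis
    next
      case False
      let ?\<alpha> = "chain_root (2 * p + 2) (2 * p + 2)"
      let ?a = "\<lambda>l. flip ?\<alpha> l * a l"
      have \<alpha>: "?\<alpha> \<in> roots n" using Suc.prems by (intro chain_root_in_roots) auto
      have a_in: "?a \<in> B" by (rule flip_closed[OF a(1) \<alpha>])
      let ?s = "\<Prod>l | l \<in> {1..n} \<and> odd (lookup ?\<alpha> l). - \<i> * (flip ?\<alpha> l * a l)"
      have "a l \<noteq> 0" if "l \<in> {1..n}" for l
        using signs[OF a(1)] that by (auto simp: sign_family_def dest: bspec[of _ _ l])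
      then have nz: "?s \<noteq> 0" by (auto simp: prod_zero_iff flip_def)
      have "smul (1/2 * ?s) (tens (vac n ?a) 1) \<in> M"
        using inv[OF Y_in_ghat[OF \<alpha>] a(2)] by (simp only: \<rho>_Y_vac[OF \<alpha> signs[OF a(1)]])
      then have "smul (2 / ?s) (smul (1/2 * ?s) (tens (vac n ?a) 1)) \<in> M"
        by (rule cvs.subspace_scale[OF sub])
      moreover have "2 / ?s * (1/2 * ?s) = 1" using nz by (simp del: prod_zero_iff)
      ultimately have "tens (vac n ?a) 1 \<in> M"
        by (simp only: cvs.scale_scale cvs.scale_one)
      moreover have "?a l = b' l" if "l < 2 * Suc p" "odd l" for l
      proof (cases "l = 2 * p + 1")
        case True
        have "2 * p + 1 \<in> {1..n}" using Suc.prems by auto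
        then have "a l = 1 \<or> a l = -1" "b' l = 1 \<or> b' l = -1"
          using signs[OF a(1)] signs[OF b'] True by (auto simp: sign_family_def)
        then show ?thesis using False True by (auto simp: flip_def lookup_chain_root)
      next
        case False
        then have "l < 2 * p" using less[of l] that by auto
        moreover from this have "flip ?\<alpha> l = 1" by (auto simp: flip_def lookup_chain_root)
        ultimately show ?thesis using a(3) that by simp
      qed
      ultimately show ?thesis using a_in by blast
    qed
  qed
  from this[of "n div 2"] obtain a where a: "a \<in> B" "tens (vac n a) 1 \<in> M"
    "\<And>l. l < 2 * (n div 2) \<Longrightarrow> odd l \<Longrightarrow> a l = b' l" by auto
  have "a l = b' l" if "odd l" "l < n" for l
  proof (rule a(3))
    show "l < 2 * (n div 2)" using that by presburger
  qed (use that in simp)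
  then have "a l = b' l" if "l \<in> {1..n}" for l
    using that determined[OF a(1) b', of l] even_fixed[OF a(1) b' that] by (cases "even l") auto
  then have "vac n a = vac n b'" by (rule vac_cong)
  then show ?thesis using a(2) by simp
qed

text \<open>
  Up to a nonzero factor, \<open>S\<^sub>k \<otimes> t\<^sup>-\<^sup>r\<close> multiplies by the variable with indices \<open>(k, r)\<close>, so every monomial can be
  built up from \<open>1\<close>.
\<close>

lemma submodule_polynomials:
  assumes M: "submodule (ghat_carrier n) \<rho> W M" and b: "tens (vac n b) 1 \<in> M"
    and f: "f \<in> pol_carrier n"
  shows "tens (vac n b) f \<in> M"
proof -
  have sub: "cvs.subspace M" and inv: "\<And>x v. x \<in> ghat_carrier n \<Longrightarrow> v \<in> M \<Longrightarrow> \<rho> x v \<in> M"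
    using M by (auto simp: submodule_def)
  have mono: "tens (vac n b) (Poly_Mapping.single N 1) \<in> M" if "keys N \<subseteq> {1..n} \<times> {r. odd r}" for N
    using that
  proof (induction "monom_degree N" arbitrary: N)
    case 0
    then have "N = 0" by (simp add: monom_degree_eq_0_iff)
    then show ?case using b by simp
  next
    case (Suc d)
    then have "N \<noteq> 0" by (metis monom_degree_eq_0_iff nat.distinct(1))
    then obtain k r where kr: "(k, r) \<in> keys N" by (rule monom_nonzero_key)
    then have k: "k \<in> {1..n}" and r: "odd r" using Suc.prems by auto
    obtain N' where N': "N = N' + Poly_Mapping.single (k, r) 1" "keys N' \<subseteq> keys N"
      using monom_split[OF kr] by blast
    have keys: "keys N' \<subseteq> {1..n} \<times> {r. odd r}" using N'(2) Suc.prems by blast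
    have "d = monom_degree N'" using Suc.hyps(2) by (simp add: N'(1) monom_degree_add)
    then have "tens (vac n b) (Poly_Mapping.single N' 1) \<in> M" using Suc.hyps(1) keys by blast
    then have "\<rho> (loop (S k) (- int r)) (tens (vac n b) (Poly_Mapping.single N' 1)) \<in> M"
      by (intro inv loop_cartan_in_ghat S_in_cartan k) (simp_all add: r)
    moreover have "heis k (- int r) (Poly_Mapping.single N' 1) = smul (of_nat r) (Poly_Mapping.single N 1)"
      by (simp add: heis_def xvar_def mult_single N'(1) add.commute)
    ultimately have "smul (of_nat r / of_real (sqrt 2)) (tens (vac n b) (Poly_Mapping.single N 1)) \<in> M"
      using \<rho>_S_vac[OF k _ single_in_pol_carrier[OF keys, of 1], where j = "- int r" and b = b] r
      by (simp add: tens_bilinear)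
    then have "smul (of_real (sqrt 2) / of_nat r) (smul (of_nat r / of_real (sqrt 2))
        (tens (vac n b) (Poly_Mapping.single N 1))) \<in> M"
      by (rule cvs.subspace_scale[OF sub])
    moreover have "r \<noteq> 0" using r by (auto intro: Nat.gr0I)
    ultimately show ?case by simp
  qed
  have "f = (\<Sum>N\<in>keys f. smul (lookup f N) (Poly_Mapping.single N 1))"
    by (rule sum_smul_single) simp_all
  then have "tens (vac n b) f = (\<Sum>N\<in>keys f. smul (lookup f N) (tens (vac n b) (Poly_Mapping.single N 1)))"
    by (metis (no_types, lifting) sum.cong tens_bilinear(4) tens_sum_right)
  also have "\<dots> \<in> M"
    using f by (intro cvs.subspace_sum[OF sub] cvs.subspace_scale[OF sub] mono) (auto simp: pol_carrier_def)
  finally show ?thesis .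
qed

lemma irreducible_W: "irreducible_module (ghat_carrier n) (ghat_bracket n) \<rho> W"
proof -
  obtain b0 where "b0 \<in> B" using nonempty by blast
  then have "tens (vac n b0) 1 \<in> W" by (rule vac_tens_in_W[OF _ one_in_pol_carrier])
  then have "W \<noteq> {0}" using tens_vac_one_nonzero by blast
  moreover have "M = {0} \<or> M = W" if M: "submodule (ghat_carrier n) \<rho> W M" for M
  proof (rule disjCI)
    assume "M \<noteq> W"
    have sub: "cvs.subspace M" "M \<subseteq> W" using M by (auto simp: submodule_def)
    show "M = {0}"
    proof (rule ccontr)
      assume "M \<noteq> {0}"
      then obtain w where "w \<in> M" "w \<noteq> 0" using cvs.subspace_0[OF sub(1)] by blast
      then obtain b where "b \<in> B" "tens (vac n b) 1 \<in> M"
        using submodule_constants[OF M] submodule_vac[OF M] by blast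
      then have "W \<subseteq> M"
        using submodule_transitive[OF M] submodule_polynomials[OF M]
        by (intro W_least[OF sub(1)]) blast
      then show False using \<open>M \<noteq> W\<close> sub(2) by blast
    qed
  qed
  ultimately show ?thesis
    unfolding irreducible_module_def using lie_module_W by blast
qed

lemma irreducible_highest_weight_W:
  assumes "b \<in> B" "singular_vector n m \<rho> (tens (vac n b) 1)"
  shows "irreducible_highest_weight_module n m \<rho> W (tens (vac n b) 1)"
proof -
  have "M = W" if "submodule (ghat_carrier n) \<rho> W M" "tens (vac n b) 1 \<in> M" for M
    using irreducible_W that tens_vac_one_nonzero unfolding irreducible_module_def by blast
  then show ?thesis
    unfolding irreducible_highest_weight_module_def
    using irreducible_W assms vac_tens_in_W[OF assms(1) one_in_pol_carrier] by blast
qed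

end

section \<open>The two parities of the rank\<close>

text \<open>
  The coefficient of \<open>\<alpha>\<close> at an even index enters the flips of both neighbouring odd indices, which
  both lie in \<open>{1..n}\<close> when \<open>n\<close> is odd; so its contributions to the product cancel.
\<close>

lemma prod_flip_odd:
  fixes b :: "nat \<Rightarrow> complex"
  assumes n: "odd n" and \<alpha>: "\<alpha> \<in> root_lattice n"
  shows "(\<Prod>l | l \<in> {1..n} \<and> odd l. flip \<alpha> l * b l) = (\<Prod>l | l \<in> {1..n} \<and> odd l. b l)"
proof -
  let ?e = "\<lambda>k. (-1 :: complex) powi lookup \<alpha> k"
  obtain p where p: "n = 2 * p + 1" using n by (auto elim: oddE)
  have odds: "{l. l \<in> {1..n} \<and> odd l} = (\<lambda>q. 2 * q + 1) ` {0..p}"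
    by (auto simp: p elim!: oddE)
  have "(\<Prod>l | l \<in> {1..n} \<and> odd l. flip \<alpha> l) = (\<Prod>q = 0..p. flip \<alpha> (2 * q + 1))"
    unfolding odds by (subst prod.reindex) (auto intro: inj_onI)
  also have "\<dots> = (\<Prod>q = 0..p. ?e (2 * q) * ?e (2 * Suc q))"
    by (rule prod.cong) (auto simp: flip_def power_int_minus_left)
  \<comment> \<open>The product telescopes, and its end terms have indices outside of \<open>{1..n}\<close>.\<close>
  also have "\<dots> = ?e 0 * ?e (2 * Suc p)"
  proof (induction p)
    case (Suc q)
    have "?e (2 * Suc q) * ?e (2 * Suc q) = 1" by (simp add: power_int_minus_left)
    then show ?case using Suc by (simp add: mult_ac)
  qed simp
  also have "\<dots> = 1"
  proof -
    have "lookup \<alpha> k = 0" if "k \<notin> {1..n}" for k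
      using \<alpha> that by (auto simp: root_lattice_def in_keys_iff)
    then have "lookup \<alpha> 0 = 0" "lookup \<alpha> (2 * Suc p) = 0" by (simp_all add: p)
    then show ?thesis by (simp del: mult_Suc_right)
  qed
  finally show ?thesis by (simp add: prod.distrib)
qed

lemma flip_even: "even l \<Longrightarrow> flip \<alpha> l = 1"
  by (simp add: flip_def)

lemma sign_family_flip: "sign_family n b \<Longrightarrow> sign_family n (\<lambda>l. flip \<alpha> l * b l)"
  by (auto simp: sign_family_def flip_def)

text \<open>
  For even \<open>n\<close> every odd index is below \<open>n\<close>, so no condition links the odd signs.
\<close>

lemma (in twisted_vertex_module) sign_component_all:
  assumes "even n" "sign_family n c"
  shows "sign_component n S \<rho> {b. sign_family n b \<and> (\<forall>j\<in>{1..n}. even j \<longrightarrow> b j = c j)}"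
proof unfold_locales
  show "{b. sign_family n b \<and> (\<forall>j\<in>{1..n}. even j \<longrightarrow> b j = c j)} \<noteq> {}"
    using assms by auto
next
  fix b b' :: "nat \<Rightarrow> complex" and l
  assume *: "\<And>l. odd l \<Longrightarrow> l < n \<Longrightarrow> b l = b' l" "odd l" "l \<in> {1..n}"
  then have "l < n" using assms(1) by (auto simp: le_less)
  then show "b l = b' l" using * by blast
qed (auto simp: sign_family_flip flip_even)

text \<open>
  For odd \<open>n\<close> the prescribed product determines the sign at \<open>n\<close> from the other odd signs.
\<close>

lemma (in twisted_vertex_module) sign_component_parity:
  assumes "odd n" "sign_family n c" "(\<Prod>j | j \<in> {1..n} \<and> odd j. c j) = e"
  shows "sign_component n S \<rho> {b. sign_family n b \<and> (\<forall>j\<in>{1..n}. even j \<longrightarrow> b j = c j) \<and>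
    (\<Prod>j | j \<in> {1..n} \<and> odd j. b j) = e}"
    (is "sign_component n S \<rho> ?B")
proof unfold_locales
  show "?B \<noteq> {}" using assms by auto
next
  fix b \<alpha> assume "b \<in> ?B" "\<alpha> \<in> roots n"
  then show "(\<lambda>l. flip \<alpha> l * b l) \<in> ?B"
    using prod_flip_odd[OF assms(1), of \<alpha> b] roots_subset_root_lattice
    by (auto simp: sign_family_flip flip_even)
next
  fix b b' :: "nat \<Rightarrow> complex" and l
  assume b: "b \<in> ?B" "b' \<in> ?B" and eq: "\<And>l. odd l \<Longrightarrow> l < n \<Longrightarrow> b l = b' l"
    and l: "odd l" "l \<in> {1..n}"
  show "b l = b' l"
  proof (cases "l = n")
    case True
    let ?O = "{j. j \<in> {1..n} \<and> odd j}"
    have n: "n \<in> ?O" "finite ?O" using l True by auto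
    have "(\<Prod>j\<in>?O - {n}. b j) = (\<Prod>j\<in>?O - {n}. b' j)"
      by (rule prod.cong) (auto intro!: eq)
    moreover have "b n * (\<Prod>j\<in>?O - {n}. b j) = b' n * (\<Prod>j\<in>?O - {n}. b' j)"
      using b prod.remove[OF n(2,1), of b] prod.remove[OF n(2,1), of b'] by simp
    moreover have "(\<Prod>j\<in>?O - {n}. b' j) \<noteq> 0"
    proof -
      have "b' j \<noteq> 0" if "j \<in> {1..n}" for j
        using b that by (auto simp: sign_family_def dest: bspec[of _ _ j])
      then show ?thesis by (auto simp: prod_zero_iff)
    qed
    ultimately show ?thesis using True by simp
  qed (use eq l in auto)
qed auto

context twisted_vertex_module
begin

lemma singular_vector_vac_odd_rank:
  assumes m: "2 \<le> m" and n: "n = 2 * m - 1" and c: "sign_family n c"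
  shows "singular_vector n m \<rho> (tens (vac n c) 1) \<longleftrightarrow> (\<forall>j\<in>{1..m-1}. c (2*j-1) = 1)"
proof -
  have idx: "2 * (m - 1) - 1 = 2 * m - 3" "2 * (m - 1) + 1 = 2 * m - 1" using m by auto
  have "singular_vector n m \<rho> (tens (vac n c) 1) \<longleftrightarrow>
      (\<forall>j\<in>{1..<m}. c (2*j-1) = 1 \<or> c (2*j+1) = -1) \<and> (c (2*m-1) = 1 \<or> c (2*m-3) = 1)"
    using singular_vector_vac_iff[OF m disjI1[OF n] c] n by blast
  also have "\<dots> \<longleftrightarrow> (\<forall>j\<in>{1..m-1}. c (2*j-1) = 1)"
  proof
    assume *: "(\<forall>j\<in>{1..<m}. c (2*j-1) = 1 \<or> c (2*j+1) = -1) \<and> (c (2*m-1) = 1 \<or> c (2*m-3) = 1)"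
    have "m - 1 \<in> {1..<m}" using m by auto
    then have "c (2*m-3) = 1 \<or> c (2*m-1) = -1" using * unfolding idx[symmetric] by blast
    moreover have "(1::complex) \<noteq> -1" by simp
    ultimately have top: "c (2*(m-1)-1) = 1" unfolding idx using * by metis
    show "\<forall>j\<in>{1..m-1}. c (2*j-1) = 1"
    proof
      fix j assume "j \<in> {1..m-1}"
      then show "c (2*j-1) = 1"
        by (rule signs_propagate[rotated 2]) (use * top in auto)
    qed
  next
    assume *: "\<forall>j\<in>{1..m-1}. c (2*j-1) = 1"
    have "m - 1 \<in> {1..m-1}" using m by auto
    then have "c (2*m-3) = 1" using * unfolding idx[symmetric] by blast
    moreover have "{1..<m} = {1..m-1}" by auto
    ultimately show "(\<forall>j\<in>{1..<m}. c (2*j-1) = 1 \<or> c (2*j+1) = -1) \<and> (c (2*m-1) = 1 \<or> c (2*m-3) = 1)"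
      using * by blast
  qed
  finally show ?thesis .
qed

lemma singular_vector_vac_even_rank:
  assumes m: "2 \<le> m" and n: "n = 2 * m" and c: "sign_family n c"
  shows "singular_vector n m \<rho> (tens (vac n c) 1) \<longleftrightarrow> (\<forall>j\<in>{1..m}. c (2*j-1) = 1)"
proof -
  have "n \<noteq> 2 * m - 1" using m n by auto
  then have "singular_vector n m \<rho> (tens (vac n c) 1) \<longleftrightarrow>
      (\<forall>j\<in>{1..<m}. c (2*j-1) = 1 \<or> c (2*j+1) = -1) \<and> c (2*m-1) = 1"
    using singular_vector_vac_iff[OF m disjI2[OF n] c] by blast
  also have "\<dots> \<longleftrightarrow> (\<forall>j\<in>{1..m}. c (2*j-1) = 1)"
  proof
    assume *: "(\<forall>j\<in>{1..<m}. c (2*j-1) = 1 \<or> c (2*j+1) = -1) \<and> c (2*m-1) = 1"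
    show "\<forall>j\<in>{1..m}. c (2*j-1) = 1"
    proof
      fix j assume "j \<in> {1..m}"
      then show "c (2*j-1) = 1"
        by (rule signs_propagate[rotated 2]) (use * in auto)
    qed
  qed (use m in auto)
  finally show ?thesis .
qed

lemma fundamental_weight_odd_rank:
  assumes m: "2 \<le> m" and n: "n = 2 * m - 1" and c: "sign_family n c"
    and ones: "\<forall>j\<in>{1..m-1}. c (2*j-1) = 1"
  shows "c (2*m-1) = 1 \<Longrightarrow> has_fundamental_weight n m \<rho> m (tens (vac n c) 1)"
    and "c (2*m-1) = -1 \<Longrightarrow> has_fundamental_weight n m \<rho> (m-1) (tens (vac n c) 1)"
proof -
  have idx: "2 * (m - 1) - 1 = 2 * m - 3" "2 * (m - 1) + 1 = 2 * m - 1" using m by auto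
  have "1 \<in> {1..m-1}" "m - 1 \<in> {1..m-1}" using m by auto
  then have c1: "c 1 = 1" and cm: "c (2*m-3) = 1"
    using ones bspec[OF ones, of 1] unfolding idx[symmetric] by auto
  have h: "\<rho> (chev_h n m j) (tens (vac n c) 1)
      = smul (if j = m - 1 then (1 - c (2*m-1)) / 2 else if j = m then (1 + c (2*m-1)) / 2 else 0)
          (tens (vac n c) 1)" if "j \<le> m" for j
  proof -
    consider "j = 0" | "0 < j" "j < m - 1" | "j = m - 1" | "j = m" using \<open>j \<le> m\<close> by linarith
    then have "(if j = 0 then (1 - c 1) / 2
       else if j < m then (c (2*j-1) - c (2*j+1)) / 2
       else if n = 2 * m then c (2*m-1)
       else (c (2*m-3) + c (2*m-1)) / 2)
      = (if j = m - 1 then (1 - c (2*m-1)) / 2 else if j = m then (1 + c (2*m-1)) / 2 else 0)"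
    proof cases
      case 1
      then show ?thesis using m c1 by auto
    next
      case 2
      then have "c (2*j-1) = 1" "c (2*Suc j-1) = 1" using ones by (auto simp del: mult_Suc_right)
      then show ?thesis using 2 by auto
    next
      case 3
      have "c (2*j-1) = 1" "c (2*j+1) = c (2*m-1)" using cm unfolding 3 idx by auto
      then show ?thesis using 3 m by auto
    next
      case 4
      then show ?thesis using m n cm by auto
    qed
    then show ?thesis using chev_h_vac[OF m disjI1[OF n] that c] by (simp only:)
  qed
  show "has_fundamental_weight n m \<rho> m (tens (vac n c) 1)" if "c (2*m-1) = 1"
    unfolding has_fundamental_weight_def using m by (auto simp: h that[simplified])
  show "has_fundamental_weight n m \<rho> (m-1) (tens (vac n c) 1)" if "c (2*m-1) = -1"
    unfolding has_fundamental_weight_def using m by (auto simp: h that[simplified])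
qed

lemma fundamental_weight_even_rank:
  assumes m: "2 \<le> m" and n: "n = 2 * m" and c: "sign_family n c"
    and ones: "\<forall>j\<in>{1..m}. c (2*j-1) = 1"
  shows "has_fundamental_weight n m \<rho> m (tens (vac n c) 1)"
  unfolding has_fundamental_weight_def
proof
  fix j assume "j \<in> {0..m}"
  then have j: "j \<le> m" by simp
  have c1: "c 1 = 1" using bspec[OF ones, of 1] m by auto
  have cm: "c (2*m-1) = 1" using bspec[OF ones, of m] m by auto
  consider "j = 0" | "0 < j" "j < m" | "j = m" using j by linarith
  then have "(if j = 0 then (1 - c 1) / 2
     else if j < m then (c (2*j-1) - c (2*j+1)) / 2
     else if n = 2 * m then c (2*m-1)
     else (c (2*m-3) + c (2*m-1)) / 2) = (if j = m then 1 else 0)"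
  proof cases
    case 1
    then show ?thesis using m c1 by auto
  next
    case 2
    then have "c (2*j-1) = 1" "c (2*Suc j-1) = 1" using ones by (auto simp del: mult_Suc_right)
    then show ?thesis using 2 by simp
  next
    case 3
    then show ?thesis using m n cm by auto
  qed
  then show "\<rho> (chev_h n m j) (tens (vac n c) 1) = smul (if j = m then 1 else 0) (tens (vac n c) 1)"
    using chev_h_vac[OF m disjI2[OF n] j c] by (simp only:)
qed

lemma irreducible_odd_rank:
  assumes m: "2 \<le> m" and n: "n = 2 * m - 1" and c: "sign_family n c"
    and ones: "\<forall>j\<in>{1..m-1}. c (2*j-1) = 1"
  shows "irreducible_highest_weight_module n m \<rho>
      (tensor_space
         (cvs.span {vac n b | b. sign_family n b \<and>
            (\<forall>j\<in>{1..n}. even j \<longrightarrow> b j = c j) \<and>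
            (\<Prod>j | j \<in> {1..n} \<and> odd j. b j) = c (2*m-1)})
         (pol_carrier n))
      (tens (vac n c) 1)"
proof -
  let ?B = "{b. sign_family n b \<and> (\<forall>j\<in>{1..n}. even j \<longrightarrow> b j = c j) \<and>
      (\<Prod>j | j \<in> {1..n} \<and> odd j. b j) = c (2*m-1)}"
  let ?O = "{j. j \<in> {1..n} \<and> odd j}"
  have n_in: "n \<in> ?O" "finite ?O" using m n by auto
  have "c j = 1" if "j \<in> ?O - {n}" for j
  proof -
    from that obtain q where q: "j = 2 * q + 1" by (auto elim: oddE)
    then have "Suc q \<in> {1..m-1}" using that n by auto
    then have "c (2 * Suc q - 1) = 1" using ones by blast
    then show ?thesis by (simp add: q)
  qed
  then have "(\<Prod>j\<in>?O. c j) = c (2*m-1)"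
    using prod.remove[OF n_in(2,1), of c] n by simp
  then interpret sign_component n S \<rho> ?B
    using m n c by (intro sign_component_parity) auto
  have "c \<in> ?B" using c \<open>(\<Prod>j\<in>?O. c j) = c (2*m-1)\<close> by simp
  then show ?thesis
    using irreducible_highest_weight_W[of c m] singular_vector_vac_odd_rank[OF m n c] ones
    by (simp only: image_Collect simp_thms)
qed

lemma irreducible_even_rank:
  assumes m: "2 \<le> m" and n: "n = 2 * m" and c: "sign_family n c"
    and ones: "\<forall>j\<in>{1..m}. c (2*j-1) = 1"
  shows "irreducible_highest_weight_module n m \<rho>
      (tensor_space
         (cvs.span {vac n b | b. sign_family n b \<and>
            (\<forall>j\<in>{1..n}. even j \<longrightarrow> b j = c j)})
         (pol_carrier n))
      (tens (vac n c) 1)"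
proof -
  let ?B = "{b. sign_family n b \<and> (\<forall>j\<in>{1..n}. even j \<longrightarrow> b j = c j)}"
  interpret sign_component n S \<rho> ?B
    using n c by (intro sign_component_all) auto
  have "c \<in> ?B" using c by simp
  then show ?thesis
    using irreducible_highest_weight_W[of c m] singular_vector_vac_even_rank[OF m n c] ones
    by (simp only: image_Collect simp_thms)
qed

end

theorem theorem4p2:
  fixes m :: nat
  assumes "m \<ge> 2"
  shows
   "(\<forall>n S \<rho>. n = 2*m - 1 \<and> orthonormal_basis n S \<and> affine_action n S \<rho> \<longrightarrow>
      (\<forall>c. sign_family n c \<longrightarrow>
         (singular_vector n m \<rho> (tens (vac n c) 1) \<longleftrightarrow> (\<forall>j\<in>{1..m-1}. c (2*j-1) = 1)) \<and>
         ((\<forall>j\<in>{1..m-1}. c (2*j-1) = 1) \<longrightarrow>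
            (c (2*m-1) = 1 \<longrightarrow> has_fundamental_weight n m \<rho> m (tens (vac n c) 1)) \<and>
            (c (2*m-1) = -1 \<longrightarrow> has_fundamental_weight n m \<rho> (m-1) (tens (vac n c) 1)) \<and>
            irreducible_highest_weight_module n m \<rho>
              (tensor_space
                 (cvs.span {vac n b | b. sign_family n b \<and>
                    (\<forall>j\<in>{1..n}. even j \<longrightarrow> b j = c j) \<and>
                    (\<Prod>j | j \<in> {1..n} \<and> odd j. b j) = c (2*m-1)})
                 (pol_carrier n))
              (tens (vac n c) 1)))) \<and>
    (\<forall>n S \<rho>. n = 2*m \<and> orthonormal_basis n S \<and> affine_action n S \<rho> \<longrightarrow>
      (\<forall>c. sign_family n c \<longrightarrow>
         (singular_vector n m \<rho> (tens (vac n c) 1) \<longleftrightarrow> (\<forall>j\<in>{1..m}. c (2*j-1) = 1)) \<and>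
         ((\<forall>j\<in>{1..m}. c (2*j-1) = 1) \<longrightarrow>
            has_fundamental_weight n m \<rho> m (tens (vac n c) 1) \<and>
            irreducible_highest_weight_module n m \<rho>
              (tensor_space
                 (cvs.span {vac n b | b. sign_family n b \<and>
                    (\<forall>j\<in>{1..n}. even j \<longrightarrow> b j = c j)})
                 (pol_carrier n))
              (tens (vac n c) 1))))"
  by ((intro conjI allI impI; elim conjE),
      (rule twisted_vertex_module.singular_vector_vac_odd_rank[OF twisted_vertex_module.intro assms]; assumption),
      (rule twisted_vertex_module.fundamental_weight_odd_rank(1)[OF twisted_vertex_module.intro assms]; assumption),
      (rule twisted_vertex_module.fundamental_weight_odd_rank(2)[OF twisted_vertex_module.intro assms]; assumption),
      (rule twisted_vertex_module.irreducible_odd_rank[OF twisted_vertex_module.intro assms]; assumption),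
      (rule twisted_vertex_module.singular_vector_vac_even_rank[OF twisted_vertex_module.intro assms]; assumption),
      (rule twisted_vertex_module.fundamental_weight_even_rank[OF twisted_vertex_module.intro assms]; assumption),
      (rule twisted_vertex_module.irreducible_even_rank[OF twisted_vertex_module.intro assms]; assumption))

end
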